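(* Consider the multi-cone SOCO pair, with primal and dual optimal sets $\mathcal P^*_{SOCO}$, $\mathcal D^*_{SOCO}$, and its primal-side SDO counterpart $(\mathcal P)$, $(\mathcal D)$, with primal and dual optimal sets $\mathcal P^*_{SDO}$, $\mathcal D^*_{SDO}$ (all defined in the context). Let $(\bar x;\bar y;\bar s)\in\mathcal P^*_{SOCO}\times\mathcal D^*_{SOCO}$ be a maximally complementary solution. If $\mathcal M$ is a proper map, then the mapped solution $(\tilde X,\tilde y,v,z,\tilde S)=\mathcal M(\bar x;\bar y;\bar s)\in\mathcal P^*_{SDO}\times\mathcal D^*_{SDO}$ is maximally complementary.
   Context: Data: $r\ge1$, dimensions $n_1,\dots,n_r$, $\bar n=\sum_in_i$, $n_0=0$, $A^i\in\mathbb R^{m\times n_i}$ with entries $a^i_{jl}$, $c^i\in\mathbb R^{n_i}$, $b\in\mathbb R^m$. $\mathcal L^k=\{x\in\mathbb R^k:x_1\ge\|x_{2:k}\|_2\}$, $x_{2:k}=(x_2,\dots,x_k)$, $\mathcal L^{\bar n}:=\mathcal L^{n_1}\times\dots\times\mathcal L^{n_r}$. $\mathrm{Arw}(x)=\begin{pmatrix}x_1&x_{2:k}^T\\ x_{2:k}&x_1I_{k-1}\end{pmatrix}$; $\mathrm{DArw}(x^1,\dots,x^r)$ is block diagonal with blocks $\mathrm{Arw}(x^1),\dots,\mathrm{Arw}(x^r)$. SOCO pair: $\min\{\sum_i(c^i)^T\bar x^i:\sum_iA^i\bar x^i=b,\ \bar x^i\in\mathcal L^{n_i}\ \forall i\}$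 and $\max\{b^T\bar y:(A^i)^T\bar y+\bar s^i=c^i,\ \bar s^i\in\mathcal L^{n_i}\ \forall i\}$; $\mathcal P^*_{SOCO}$, $\mathcal D^*_{SOCO}$ are the sets of optimal $\bar x=(\bar x^1;\dots;\bar x^r)$ and optimal $(\bar y;\bar s)$. SDO data ($\bar n\times\bar n$ matrices): $\tilde{\mathtt C}$ is block diagonal with blocks $\mathrm{Arw}(\frac1{n_i}c^i_1,\frac12c^i_2,\dots,\frac12c^i_{n_i})$; $\tilde{\mathtt A}_j$ is block diagonal with blocks $\mathrm{Arw}(\frac1{n_i}a^i_{j1},\frac12a^i_{j2},\dots,\frac12a^i_{jn_i})$, $i=1,\dots,r$. Let $\mathrm{Cf}(h)$ be the index of the block containing row $h$. $\mathcal I$ is the set of pairs $(h,l)$, $1\le h<l\le\bar n$, with either $l>\sum_{t=0}^{\mathrm{Cf}(h)}n_t$, or $\sum_{t=0}^{\mathrm{Cf}(h)-1}n_t+1<h<l\le\sum_{t=0}^{\mathrm{Cf}(h)}n_t$. $\mathcal K$ is the set of $k$ with $\sum_{t=0}^{\mathrm{Cf}(k)-1}n_t+1<k\le\sum_{t=0}^{\mathrm{Cf}(k)}n_t$. $\tilde{\check{\mathtt A}}_{hl}$ has entries $1$ at $(h,l)$, $(l,h)$ and zeros elsewhere; $\tilde{\hat{\mathtt A}}_k$ has entry $-1$ at $(k,k)$, $1$ at $(p,p)$ with $p=\sum_{t=0}^{\mathrm{Cf}(k)-1}n_t+1$, and zeros elsewhere. $(\mathcal P)$: $\min\mathrm{Tr}(\tilde{\mathtt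 C}\tilde X)$ s.t. $\mathrm{Tr}(\tilde{\mathtt A}_j\tilde X)=b_j$ ($j=1,\dots,m$), $\mathrm{Tr}(\tilde{\check{\mathtt A}}_{hl}\tilde X)=0$ ($(h,l)\in\mathcal I$), $\mathrm{Tr}(\tilde{\hat{\mathtt A}}_k\tilde X)=0$ ($k\in\mathcal K$), $\tilde X\succeq0$. $(\mathcal D)$: $\max b^T\tilde y$ s.t. $\sum_j\tilde y_j\tilde{\mathtt A}_j+\sum_{(h,l)\in\mathcal I}v_{hl}\tilde{\check{\mathtt A}}_{hl}+\sum_{k\in\mathcal K}z_k\tilde{\hat{\mathtt A}}_k+\tilde S=\tilde{\mathtt C}$, $\tilde S\succeq0$. $\mathcal P^*_{SDO}$, $\mathcal D^*_{SDO}$ are the sets of optimal $\tilde X$ and optimal $(\tilde y,v,z,\tilde S)$. Maximally complementary: a primal-dual optimal solution of either pair whose primal part lies in the relative interior of the primal optimal set and whose dual part (all dual variables including slack) lies in the relative interior of the dual optimal set. Admissible maps (primal side): $\mathcal M(\bar x;\bar y;\bar s)=(\tilde X,\tilde y,v,z,\tilde S)$ with $\tilde X=\mathrm{DArw}(\bar x^1,\dots,\bar x^r)$, $\tilde y=\bar y$, $\tilde S\succeq0$ block diagonal with symmetric $n_i\times n_i$ blocks, satisfying $\sum_{j=u_i}^{u_i+n_i-1}\tilde S_{jj}=\bar s^i_1$ and $\tilde S_{u_i,u_i+j-1}=\bar s^i_j/2$ for $j=2,\dots,n_i$, $i=1,\dots,r$, where $u_i=1+\sum_{k=0}^{i-1}n_k$,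 and with $v,z$ the values making the equality constraint of $(\mathcal D)$ hold; such maps preserve feasibility and objective values. Proper map: let $\rho(\bar s)$ be the maximum rank of $\tilde S$ over all admissible maps, i.e. over all block-diagonal $\tilde S\succeq0$ with symmetric $n_i\times n_i$ blocks satisfying $\sum_{j=u_i}^{u_i+n_i-1}\tilde S_{jj}=\bar s^i_1$ and $\tilde S_{u_i,u_i+j-1}=\bar s^i_j/2$ for $j=2,\dots,n_i$, $i=1,\dots,r$. An admissible map $\mathcal M$ is proper (primal side) if $\mathrm{rank}(\tilde S)=\rho(\bar s)$ for all $\bar s\in\mathcal L^{\bar n}$. *)

theory Defs
  imports "HOL-Analysis.Analysis"
begin

(* The space of all blocks together, of dimension nbar = n_1 + ... + n_r, is real^'k with
   CARD('k) = nbar, where the finite linearly ordered type 'k plays the role of 1 < 2 < ... < nbar.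
   A tuple (x^1; ...; x^r) is the concatenated vector in real^'k, and (A^1, ..., A^r) is the
   concatenated m x nbar matrix in real^'k^'m. *)

type_synonym 'k rvec = "(real, 'k) vec"
type_synonym ('k, 'm) rmat = "((real, 'k) vec, 'm) vec"  (* = real^'k^'m *)

definition pos :: "'k::{finite,linorder} \<Rightarrow> nat"
  where "pos h = card {g. g \<le> h}"

definition ix :: "nat \<Rightarrow> 'k::{finite,linorder}"
  where "ix p = (THE h. pos h = p)"

(* off n i = n_0 + ... + n_i with n_0 = 0; the value n 0 is never used. *)
definition off :: "(nat \<Rightarrow> nat) \<Rightarrow> nat \<Rightarrow> nat"
  where "off n i = (\<Sum>t = 1..i. n t)"

definition ublk :: "(nat \<Rightarrow> nat) \<Rightarrow> nat \<Rightarrow> nat"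
  where "ublk n i = 1 + off n (i - 1)"

definition Cf :: "(nat \<Rightarrow> nat) \<Rightarrow> 'k::{finite,linorder} \<Rightarrow> nat"
  where "Cf n h = (THE i. 1 \<le> i \<and> off n (i - 1) < pos h \<and> pos h \<le> off n i)"

(* blk n x i l = x^i_l, for 1 <= l <= n_i *)
definition blk :: "(nat \<Rightarrow> nat) \<Rightarrow> ('k::{finite,linorder}) rvec \<Rightarrow> nat \<Rightarrow> nat \<Rightarrow> real"
  where "blk n x i l = x $ ix (ublk n i + l - 1)"

definition lorentz :: "nat \<Rightarrow> (nat \<Rightarrow> real) set"
  where "lorentz d = {x. x 1 \<ge> L2_set x {2..d}}"

definition lorentz_prod :: "nat \<Rightarrow> (nat \<Rightarrow> nat) \<Rightarrow> ('k::{finite,linorder}) rvec set"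
  where "lorentz_prod r n = {x. \<forall>i\<in>{1..r}. blk n x i \<in> lorentz (n i)}"

(* entry (p, q) of the arrowhead matrix, 1-based *)
definition arw :: "(nat \<Rightarrow> real) \<Rightarrow> nat \<Rightarrow> nat \<Rightarrow> real"
  where "arw x p q = (if p = q then x 1 else if p = 1 then x q else if q = 1 then x p else 0)"

(* f i is the i-th block vector; rows and columns within a block are numbered from 1. *)
definition DArw :: "(nat \<Rightarrow> nat) \<Rightarrow> (nat \<Rightarrow> nat \<Rightarrow> real) \<Rightarrow> ('k::{finite,linorder}, 'k) rmat"
  where "DArw n f = (\<chi> h l. if Cf n h = Cf n l
     then arw (f (Cf n h)) (pos h - off n (Cf n h - 1)) (pos l - off n (Cf n h - 1)) else 0)"

definition wt :: "(nat \<Rightarrow> nat) \<Rightarrow> (nat \<Rightarrow> nat \<Rightarrow> real) \<Rightarrow> nat \<Rightarrow> nat \<Rightarrow> real"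
  where "wt n f i l = (if l = 1 then 1 / real (n i) * f i 1 else 1 / 2 * f i l)"

definition psd :: "('k::finite, 'k) rmat \<Rightarrow> bool"
  where "psd S \<longleftrightarrow> transpose S = S \<and> (\<forall>x. 0 \<le> x \<bullet> (S *v x))"

definition P_SOCO :: "nat \<Rightarrow> (nat \<Rightarrow> nat) \<Rightarrow> ('k::{finite,linorder}, 'm::finite) rmat \<Rightarrow> 'm rvec \<Rightarrow> 'k rvec \<Rightarrow> bool"
  where "P_SOCO r n A b x \<longleftrightarrow> A *v x = b \<and> x \<in> lorentz_prod r n"

definition D_SOCO :: "nat \<Rightarrow> (nat \<Rightarrow> nat) \<Rightarrow> ('k::{finite,linorder}, 'm::finite) rmat \<Rightarrow> 'k rvec
    \<Rightarrow> 'm rvec \<times> 'k rvec \<Rightarrow> bool"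
  where "D_SOCO r n A c = (\<lambda>(y, s). transpose A *v y + s = c \<and> s \<in> lorentz_prod r n)"

definition P_SOCO_opt :: "nat \<Rightarrow> (nat \<Rightarrow> nat) \<Rightarrow> ('k::{finite,linorder}, 'm::finite) rmat \<Rightarrow> 'm rvec \<Rightarrow> 'k rvec
    \<Rightarrow> 'k rvec set"
  where "P_SOCO_opt r n A b c = {x. is_arg_min (\<lambda>x. c \<bullet> x) (P_SOCO r n A b) x}"

definition D_SOCO_opt :: "nat \<Rightarrow> (nat \<Rightarrow> nat) \<Rightarrow> ('k::{finite,linorder}, 'm::finite) rmat \<Rightarrow> 'm rvec \<Rightarrow> 'k rvec
    \<Rightarrow> ('m rvec \<times> 'k rvec) set"
  where "D_SOCO_opt r n A b c = {d. is_arg_max (\<lambda>(y, s). b \<bullet> y) (D_SOCO r n A c) d}"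

definition C_til :: "(nat \<Rightarrow> nat) \<Rightarrow> ('k::{finite,linorder}) rvec \<Rightarrow> ('k, 'k) rmat"
  where "C_til n c = DArw n (wt n (blk n c))"

definition A_til :: "(nat \<Rightarrow> nat) \<Rightarrow> ('k::{finite,linorder}, 'm::finite) rmat \<Rightarrow> 'm \<Rightarrow> ('k, 'k) rmat"
  where "A_til n A j = DArw n (wt n (blk n (A $ j)))"

definition Iset :: "(nat \<Rightarrow> nat) \<Rightarrow> ('k::{finite,linorder} \<times> 'k) set"
  where "Iset n = {(h, l). h < l \<and>
     (pos l > off n (Cf n h) \<or>
      off n (Cf n h - 1) + 1 < pos h \<and> pos l \<le> off n (Cf n h))}"

definition Kset :: "(nat \<Rightarrow> nat) \<Rightarrow> ('k::{finite,linorder}) set"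
  where "Kset n = {k. off n (Cf n k - 1) + 1 < pos k \<and> pos k \<le> off n (Cf n k)}"

definition A_check :: "'k::finite \<Rightarrow> 'k \<Rightarrow> ('k, 'k) rmat"
  where "A_check h l = (\<chi> p q. if (p, q) = (h, l) \<or> (p, q) = (l, h) then 1 else 0)"

definition A_hat :: "(nat \<Rightarrow> nat) \<Rightarrow> 'k::{finite,linorder} \<Rightarrow> ('k, 'k) rmat"
  where "A_hat n k = (\<chi> p q. if p = k \<and> q = k then - 1
     else if p = ix (off n (Cf n k - 1) + 1) \<and> q = ix (off n (Cf n k - 1) + 1) then 1 else 0)"

definition P_SDO :: "(nat \<Rightarrow> nat) \<Rightarrow> ('k::{finite,linorder}, 'm::finite) rmat \<Rightarrow> 'm rvec \<Rightarrow> ('k, 'k) rmat \<Rightarrow> bool"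
  where "P_SDO n A b X \<longleftrightarrow>
     (\<forall>j. trace (A_til n A j ** X) = b $ j) \<and>
     (\<forall>(h, l)\<in>Iset n. trace (A_check h l ** X) = 0) \<and>
     (\<forall>k\<in>Kset n. trace (A_hat n k ** X) = 0) \<and>
     psd X"

(* The multipliers v (indexed by Iset) and z (indexed by Kset) are padded by zeros to elements of
   real^'k^'k and real^'k. This is a linear embedding, so relative interiors are unaffected. *)
definition supp_vz :: "(nat \<Rightarrow> nat) \<Rightarrow> ('k::{finite,linorder}, 'k) rmat \<Rightarrow> 'k rvec \<Rightarrow> bool"
  where "supp_vz n v z \<longleftrightarrow>
     (\<forall>h l. (h, l) \<notin> Iset n \<longrightarrow> v $ h $ l = 0) \<and> (\<forall>k. k \<notin> Kset n \<longrightarrow> z $ k = 0)"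

type_synonym ('k, 'm) sdo_dual = "'m rvec \<times> ('k, 'k) rmat \<times> 'k rvec \<times> ('k, 'k) rmat"

definition D_SDO_eq :: "(nat \<Rightarrow> nat) \<Rightarrow> ('k::{finite,linorder}, 'm::finite) rmat \<Rightarrow> 'k rvec
    \<Rightarrow> ('k, 'm) sdo_dual \<Rightarrow> bool"
  where "D_SDO_eq n A c = (\<lambda>(y, v, z, S).
     (\<Sum>j\<in>UNIV. y $ j *\<^sub>R A_til n A j) + (\<Sum>(h, l)\<in>Iset n. v $ h $ l *\<^sub>R A_check h l)
       + (\<Sum>k\<in>Kset n. z $ k *\<^sub>R A_hat n k) + S = C_til n c)"

definition D_SDO :: "(nat \<Rightarrow> nat) \<Rightarrow> ('k::{finite,linorder}, 'm::finite) rmat \<Rightarrow> 'k rvec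
    \<Rightarrow> ('k, 'm) sdo_dual \<Rightarrow> bool"
  where "D_SDO n A c = (\<lambda>(y, v, z, S). supp_vz n v z \<and> D_SDO_eq n A c (y, v, z, S) \<and> psd S)"

definition P_SDO_opt :: "(nat \<Rightarrow> nat) \<Rightarrow> ('k::{finite,linorder}, 'm::finite) rmat \<Rightarrow> 'm rvec \<Rightarrow> 'k rvec
    \<Rightarrow> ('k, 'k) rmat set"
  where "P_SDO_opt n A b c = {X. is_arg_min (\<lambda>X. trace (C_til n c ** X)) (P_SDO n A b) X}"

definition D_SDO_opt :: "(nat \<Rightarrow> nat) \<Rightarrow> ('k::{finite,linorder}, 'm::finite) rmat \<Rightarrow> 'm rvec \<Rightarrow> 'k rvec
    \<Rightarrow> ('k, 'm) sdo_dual set"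
  where "D_SDO_opt n A b c = {d. is_arg_max (\<lambda>(y, v, z, S). b \<bullet> y) (D_SDO n A c) d}"

definition max_complementary :: "'a::euclidean_space set \<Rightarrow> 'b::euclidean_space set \<Rightarrow> 'a \<times> 'b \<Rightarrow> bool"
  where "max_complementary P D = (\<lambda>(p, d).
     (p, d) \<in> P \<times> D \<and> p \<in> rel_interior P \<and> d \<in> rel_interior D)"

definition admissible_slack :: "nat \<Rightarrow> (nat \<Rightarrow> nat) \<Rightarrow> ('k::{finite,linorder}) rvec \<Rightarrow> ('k, 'k) rmat \<Rightarrow> bool"
  where "admissible_slack r n s S \<longleftrightarrow>
     psd S \<and> (\<forall>h l. Cf n h \<noteq> Cf n l \<longrightarrow> S $ h $ l = 0) \<and>
     (\<forall>i\<in>{1..r}.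
        (\<Sum>j = ublk n i..ublk n i + n i - 1. S $ ix j $ ix j) = blk n s i 1 \<and>
        (\<forall>j\<in>{2..n i}. S $ ix (ublk n i) $ ix (ublk n i + j - 1) = blk n s i j / 2))"

definition rho :: "nat \<Rightarrow> (nat \<Rightarrow> nat) \<Rightarrow> ('k::{finite,linorder}) rvec \<Rightarrow> nat"
  where "rho r n s = Max {rank S |S. admissible_slack r n s S}"

(* Multipliers v, z satisfying the equality constraint exist exactly when A^T y + s = c, so the
   equality is demanded at those points only. *)
definition admissible_map :: "nat \<Rightarrow> (nat \<Rightarrow> nat) \<Rightarrow> ('k::{finite,linorder}, 'm::finite) rmat \<Rightarrow> 'k rvec
    \<Rightarrow> ('k rvec \<times> 'm rvec \<times> 'k rvec \<Rightarrow> ('k, 'k) rmat \<times> ('k, 'm) sdo_dual) \<Rightarrow> bool"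
  where "admissible_map r n A c M \<longleftrightarrow>
     (\<forall>x\<in>lorentz_prod r n. \<forall>y. \<forall>s\<in>lorentz_prod r n. \<forall>X y' v z S.
        M (x, y, s) = (X, y', v, z, S) \<longrightarrow>
          X = DArw n (blk n x) \<and> y' = y \<and> admissible_slack r n s S \<and> supp_vz n v z \<and>
          (transpose A *v y + s = c \<longrightarrow> D_SDO_eq n A c (y', v, z, S)))"

definition proper_soco_map :: "nat \<Rightarrow> (nat \<Rightarrow> nat) \<Rightarrow> ('k::{finite,linorder}, 'm::finite) rmat \<Rightarrow> 'k rvec
    \<Rightarrow> ('k rvec \<times> 'm rvec \<times> 'k rvec \<Rightarrow> ('k, 'k) rmat \<times> ('k, 'm) sdo_dual) \<Rightarrow> bool"
  where "proper_soco_map r n A c M \<longleftrightarrow> admissible_map r n A c M \<and>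
     (\<forall>x\<in>lorentz_prod r n. \<forall>y. \<forall>s\<in>lorentz_prod r n. \<forall>X y' v z S.
        M (x, y, s) = (X, y', v, z, S) \<longrightarrow> rank S = rho r n s)"

end

(* Writing S -> contract S for the adjoint of x -> Arw(x), the primal SDO feasible set is the image of the
   SOCO one under the injective linear map x -> Arw(x), which settles the primal relative interior. On the
   dual side (y, v, z, S) is optimal iff it is feasible and (y, contract S) is optimal for the SOCO dual,
   and a feasible point lies in the relative interior of the optimal set if the kernel of its slack S is
   contained in the kernel of every optimal slack S'. For S of maximal rank over a relatively interior s
   this holds: s is a proper convex combination of contract S' and some other s'' in the cone, hence the
   block diagonal part of S' contributes to a matrix admissible for s, and maximality of the rank
   forces the kernel of S into the kernel of every admissible matrix. *)
theory Submission
  imports Defs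
begin

section \<open>Positions in the linearly ordered index type\<close>

lemma pos_le_iff: "pos h \<le> pos l \<longleftrightarrow> h \<le> (l :: 'k::{finite,linorder})"
proof
  show "h \<le> l" if "pos h \<le> pos l"
  proof (rule ccontr)
    assume "\<not> h \<le> l"
    then have "{g. g \<le> l} \<subset> {g. g \<le> h}"
      by auto
    from psubset_card_mono[OF _ this] that show False
      by (simp add: pos_def)
  qed
qed (auto simp: pos_def intro!: card_mono)

lemma pos_less_iff: "pos h < pos l \<longleftrightarrow> h < (l :: 'k::{finite,linorder})"
  using pos_le_iff[of l h] by (metis not_le)

lemma pos_eq_iff: "pos h = pos l \<longleftrightarrow> h = (l :: 'k::{finite,linorder})"
  using pos_le_iff[of l h] pos_le_iff[of h l] by (metis order_antisym_conv order_refl)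

lemma ix_pos [simp]: "ix (pos h) = h"
  by (simp add: ix_def pos_eq_iff)

lemma pos_range: "pos ` (UNIV :: 'k::{finite,linorder} set) = {1..CARD('k)}"
proof (rule card_subset_eq)
  have "0 < pos h" for h :: 'k
    unfolding pos_def by (rule card_gt_0_iff[THEN iffD2]) auto
  then show "pos ` (UNIV :: 'k set) \<subseteq> {1..CARD('k)}"
    by (force simp: pos_def Suc_le_eq intro: card_mono)
  have "inj (pos :: 'k \<Rightarrow> nat)"
    by (auto simp: inj_def pos_eq_iff)
  then show "card (pos ` (UNIV :: 'k set)) = card {1..CARD('k)}"
    by (simp add: card_image)
qed simp

lemma pos_ix: "1 \<le> p \<Longrightarrow> p \<le> CARD('k) \<Longrightarrow> pos (ix p :: 'k::{finite,linorder}) = p"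
proof -
  assume "1 \<le> p" "p \<le> CARD('k)"
  then obtain h :: 'k where "p = pos h"
    using pos_range[where 'k='k] by (metis atLeastAtMost_iff imageE)
  then show ?thesis
    by simp
qed

section \<open>Offsets, blocks and their heads\<close>

lemma off_mono: "i \<le> j \<Longrightarrow> off n i \<le> off n j"
  unfolding off_def by (intro sum_mono2) auto

lemma off_step: "1 \<le> i \<Longrightarrow> off n i = off n (i - 1) + n i"
  by (cases i) (auto simp: off_def)

text \<open>\<open>head h\<close> is the first index of the block of \<open>h\<close>. Blocks are
  handled below as fibres of the idempotent map \<open>head\<close>, so offsets and block numbers
  serve only to translate the given definitions.\<close>

locale block_structure =
  fixes r :: nat and n :: "nat \<Rightarrow> nat" and head :: "'k::{finite,linorder} \<Rightarrow> 'k"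
  assumes n_pos: "i \<in> {1..r} \<Longrightarrow> n i \<ge> 1"
    and card_total: "CARD('k) = (\<Sum>i = 1..r. n i)"
    and head_eq: "head h = ix (ublk n (Cf n h))"
begin

lemma block_of_exists:
  assumes "1 \<le> p" "p \<le> off n r"
  shows "\<exists>i\<in>{1..r}. off n (i - 1) < p \<and> p \<le> off n i"
proof -
  \<comment> \<open>The block of \<open>p\<close> is the first one whose right end reaches
    \<open>p\<close>; minimality puts \<open>p\<close> beyond the previous end, and
    \<open>off n 0 = 0\<close> excludes the index 0.\<close>
  define i where "i = (LEAST i. p \<le> off n i)"
  have 1: "p \<le> off n i"
    unfolding i_def using assms by (intro LeastI) auto
  have "i \<noteq> 0"
    using 1 assms by (auto simp: off_def intro: Nat.gr0I)
  moreover have "\<not> p \<le> off n (i - 1)"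
    using not_less_Least[of "i - 1" "\<lambda>i. p \<le> off n i"] \<open>i \<noteq> 0\<close> by (simp add: i_def)
  moreover have "i \<le> r"
    unfolding i_def using assms by (intro Least_le) auto
  ultimately show ?thesis
    using 1 by (intro bexI[of _ i]) auto
qed

lemma block_of_unique:
  assumes "off n (i - 1) < p" "p \<le> off n i" "off n (j - 1) < p" "p \<le> off n j"
  shows "i = j"
proof -
  have "\<not> i \<le> j - 1" "\<not> j \<le> i - 1"
    using off_mono[of i "j - 1" n] off_mono[of j "i - 1" n] assms by linarith+
  then show ?thesis
    by linarith
qed

lemma pos_bounds: "1 \<le> pos (h :: 'k)" "pos (h :: 'k) \<le> off n r"
  using pos_range[where 'k='k] card_total by (auto simp: off_def set_eq_iff)

lemma CfI:
  assumes "1 \<le> i" "off n (i - 1) < pos (h :: 'k)" "pos h \<le> off n i"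
  shows "Cf n h = i"
  unfolding Cf_def using assms by (intro the_equality) (auto intro: block_of_unique)

lemma Cf_props: "Cf n (h :: 'k) \<in> {1..r}" "off n (Cf n h - 1) < pos h" "pos h \<le> off n (Cf n h)"
  using block_of_exists[OF pos_bounds[of h]] CfI[of _ h] by auto

lemma pos_block_ix:
  assumes "i \<in> {1..r}" "l \<in> {1..n i}"
  shows "pos (ix (ublk n i + l - 1) :: 'k) = off n (i - 1) + l"
    and "Cf n (ix (ublk n i + l - 1) :: 'k) = i"
proof -
  have "off n (i - 1) + l \<le> off n i"
    using assms off_step[of i n] by auto
  moreover have "off n i \<le> CARD('k)"
    using off_mono[of i r n] assms card_total by (simp add: off_def)
  ultimately show *: "pos (ix (ublk n i + l - 1) :: 'k) = off n (i - 1) + l"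
    using assms by (subst pos_ix) (auto simp: ublk_def)
  then show "Cf n (ix (ublk n i + l - 1) :: 'k) = i"
    using assms \<open>_ \<le> off n i\<close> by (intro CfI) auto
qed

lemma pos_head: "pos (head h) = off n (Cf n h - 1) + 1"
  and Cf_head: "Cf n (head h) = Cf n h"
  using pos_block_ix[of "Cf n h" 1] n_pos[OF Cf_props(1)[of h]] Cf_props(1)[of h]
  by (auto simp: head_eq)

lemma head_eq_iff: "head h = head l \<longleftrightarrow> Cf n h = Cf n l"
  by (metis Cf_head head_eq)

lemma head_idem [simp]: "head (head h) = head h"
  by (simp add: head_eq_iff Cf_head)

lemma head_le: "head h \<le> h"
  using Cf_props(2)[of h] by (simp add: pos_head flip: pos_le_iff)

definition block :: "'k \<Rightarrow> 'k set"
  where "block p = {h. head h = p}"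

text \<open>Links the numbering within a block, with the head at number 1, to the index set
  \<open>block p\<close>; sums and quantifiers over the two are exchanged through this
  injection.\<close>

lemma block_pos_image:
  assumes "head p = p"
  shows "block p = (\<lambda>j. ix (ublk n (Cf n p) + j - 1)) ` {1..n (Cf n p)}"
    and "block p - {p} = (\<lambda>j. ix (ublk n (Cf n p) + j - 1)) ` {2..n (Cf n p)}"
    and "inj_on (\<lambda>j. ix (ublk n (Cf n p) + j - 1) :: 'k) {1..n (Cf n p)}"
proof -
  let ?i = "Cf n p" and ?g = "\<lambda>j. ix (ublk n (Cf n p) + j - 1) :: 'k"
  have i: "?i \<in> {1..r}"
    by (rule Cf_props)
  show inj: "inj_on ?g {1..n ?i}"
    using pos_block_ix(1)[OF i] by (intro inj_onI) (metis add_left_cancel)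
  have g: "?g (pos h - off n (?i - 1)) = h" if "Cf n h = ?i" for h
    using Cf_props(2)[of h] that by (simp add: ublk_def)
  show b: "block p = ?g ` {1..n ?i}"
  proof safe
    fix h assume "h \<in> block p"
    then have h: "Cf n h = ?i"
      using assms head_eq_iff[of h p] by (simp add: block_def)
    moreover have "pos h - off n (?i - 1) \<in> {1..n ?i}"
      using Cf_props(2,3)[of h] h off_step[of ?i n] i by auto
    ultimately show "h \<in> ?g ` {1..n ?i}"
      using g[OF h] by (intro image_eqI[of _ _ "pos h - off n (?i - 1)"]) auto
  next
    fix j assume "j \<in> {1..n ?i}"
    from pos_block_ix(2)[OF i this] show "?g j \<in> block p"
      using assms head_eq_iff[of "?g j" p] by (simp add: block_def)
  qed
  have "p = ?g 1"
    using assms head_eq[of p] by simp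
  then have "block p - {p} = ?g ` ({1..n ?i} - {1})"
    using b inj n_pos[OF i] by (subst inj_on_image_set_diff[OF inj]) auto
  also have "{1..n ?i} - {1} = {2..n ?i}"
    by auto
  finally show "block p - {p} = ?g ` {2..n ?i}" .
qed

lemma card_block: "card (block (head h)) = n (Cf n h)"
  using card_image[OF block_pos_image(3)[of "head h"]] block_pos_image(1)[of "head h"]
  by (simp add: Cf_head)

lemma blk_self: "blk n x (Cf n h) (pos (h :: 'k) - off n (Cf n h - 1)) = x $ h"
  using Cf_props(2)[of h] by (simp add: blk_def ublk_def)

lemma blk_head: "blk n x (Cf n h) (Suc 0) = x $ head h"
  by (simp add: blk_def head_eq)

lemma index_eq_1_iff: "pos h - off n (Cf n h - 1) = Suc 0 \<longleftrightarrow> h = head h"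
  using pos_head[of h] Cf_props(2)[of h] pos_eq_iff[of h "head h"] by auto

lemma block_index_surj: "i \<in> {1..r} \<Longrightarrow> \<exists>p. head p = p \<and> Cf n p = i"
  using pos_block_ix(2)[of i 1] n_pos[of i]
  by (intro exI[of _ "head (ix (ublk n i + 1 - 1))"]) (auto simp: Cf_head)

lemma blk_L2_set:
  assumes "head p = p"
  shows "L2_set (blk n x (Cf n p)) {2..n (Cf n p)} = L2_set (($) x) (block p - {p})"
proof -
  have "inj_on (\<lambda>j. ix (ublk n (Cf n p) + j - 1) :: 'k) {2..n (Cf n p)}"
    by (rule inj_on_subset[OF block_pos_image(3)[OF assms]]) auto
  then show ?thesis
    by (simp add: block_pos_image(2)[OF assms] L2_set_def sum.reindex blk_def o_def)
qed

text \<open>Every block is nonempty by \<open>n_pos\<close>, so its head can stand for its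
  number.\<close>

lemma all_blocks_iff: "(\<forall>i\<in>{1..r}. Q i) \<longleftrightarrow> (\<forall>p. head p = p \<longrightarrow> Q (Cf n p))"
proof safe
  fix i assume *: "\<forall>p. head p = p \<longrightarrow> Q (Cf n p)" and "i \<in> {1..r}"
  then show "Q i"
    using block_index_surj[of i] by blast
qed (use Cf_props(1) in blast)

lemma lorentz_prod_iff:
  "x \<in> lorentz_prod r n \<longleftrightarrow> (\<forall>p. head p = p \<longrightarrow> L2_set (($) x) (block p - {p}) \<le> x $ p)"
proof -
  have "blk n x (Cf n p) \<in> lorentz (n (Cf n p)) \<longleftrightarrow> L2_set (($) x) (block p - {p}) \<le> x $ p"
    if "head p = p" for p
    using blk_L2_set[OF that, of x] blk_head[of x p] that by (simp add: lorentz_def)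
  then show ?thesis
    unfolding lorentz_prod_def mem_Collect_eq
    by (subst all_blocks_iff[where Q = "\<lambda>i. blk n x i \<in> lorentz (n i)"]) blast
qed

text \<open>These are the strictly upper triangular positions where every arrow matrix vanishes.
  Since \<open>h < l\<close>, the index \<open>l\<close> is never the head of a common block, so
  only \<open>h\<close> has to be tested.\<close>

lemma Iset_eq: "Iset n = {(h, l). h < l \<and> (head h = head l \<longrightarrow> h \<noteq> head h)}"
proof -
  have "off n (Cf n h) < pos l \<or> off n (Cf n h - 1) + 1 < pos h \<and> pos l \<le> off n (Cf n h)
      \<longleftrightarrow> (head h = head l \<longrightarrow> h \<noteq> head h)" if "h < l" for h l :: 'k
  proof (cases "Cf n h = Cf n l")
    case True
    then show ?thesis
      using Cf_props(2,3)[of l] Cf_props(2)[of h] pos_head[of h] pos_eq_iff[of h "head h"]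
      by (auto simp: head_eq_iff)
  next
    case False
    moreover have "pos h < pos l"
      using that by (simp add: pos_less_iff)
    ultimately have "\<not> pos l \<le> off n (Cf n h)"
      using CfI[of "Cf n h" l] Cf_props[of h] by auto
    then show ?thesis
      using False by (auto simp: head_eq_iff)
  qed
  then show ?thesis
    by (auto simp: Iset_def)
qed

lemma Kset_eq: "Kset n = {k. k \<noteq> head k}"
proof -
  have "off n (Cf n k - 1) + 1 < pos k \<longleftrightarrow> k \<noteq> head k" for k :: 'k
    using Cf_props(2)[of k] pos_head[of k] pos_eq_iff[of k "head k"] by auto
  then show ?thesis
    using Cf_props(3) by (auto simp: Kset_def)
qed

lemma A_hat_eq: "A_hat n k = (\<chi> p q. if p = k \<and> q = k then - 1
    else if p = head k \<and> q = head k then 1 else 0)"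
proof -
  have "ix (off n (Cf n k - 1) + 1) = head k"
    by (simp add: head_eq ublk_def)
  then show ?thesis
    by (simp only: A_hat_def)
qed

end

section \<open>Positive semidefinite matrices: kernels, ranges and extrapolation\<close>

lemma psd_sym: "psd S \<Longrightarrow> S $ h $ l = S $ l $ h"
  unfolding psd_def by (metis transpose_def vec_lambda_beta)

lemma psd_inner_sym: "psd S \<Longrightarrow> x \<bullet> (S *v y) = y \<bullet> (S *v x)"
  unfolding psd_def by (metis dot_lmul_matrix inner_commute transpose_matrix_vector)

lemma psd_Cauchy_Schwarz:
  assumes "psd S"
  shows "(x \<bullet> (S *v y))\<^sup>2 \<le> (x \<bullet> (S *v x)) * (y \<bullet> (S *v y))"
proof -
  define a b c where abc: "a = x \<bullet> (S *v x)" "b = x \<bullet> (S *v y)" "c = y \<bullet> (S *v y)"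
  \<comment> \<open>The form at combinations of \<open>x\<close> and \<open>y\<close>. Taking (s, t)
    to be (-b, a), (c, -b) or (1, -b) yields the bound when \<open>a > 0\<close>, when
    \<open>c > 0\<close>, or when both vanish.\<close>
  have q: "0 \<le> s\<^sup>2 * a + 2 * s * t * b + t\<^sup>2 * c" for s t
  proof -
    have "0 \<le> (s *\<^sub>R x + t *\<^sub>R y) \<bullet> (S *v (s *\<^sub>R x + t *\<^sub>R y))"
      using assms by (simp add: psd_def)
    also have "\<dots> = s\<^sup>2 * a + 2 * s * t * b + t\<^sup>2 * c"
      using psd_inner_sym[OF assms, of y x]
      by (simp add: abc matrix_vector_right_distrib matrix_vector_mult_scaleR inner_simps algebra_simps power2_eq_square)
    finally show ?thesis .
  qed
  have nonneg: "0 \<le> a" "0 \<le> c"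
    using assms by (auto simp: abc psd_def)
  consider "a = 0" "c = 0" | "a > 0" | "c > 0"
    using nonneg by force
  then have "b\<^sup>2 \<le> a * c"
  proof cases
    case 1
    then show ?thesis
      using q[of 1 "- b"] by (simp add: power2_eq_square)
  next
    case 2
    moreover have "0 \<le> a * (a * c - b\<^sup>2)"
      using q[of "- b" a] by (simp add: algebra_simps power2_eq_square)
    ultimately show ?thesis
      by (simp add: zero_le_mult_iff)
  next
    case 3
    moreover have "0 \<le> c * (a * c - b\<^sup>2)"
      using q[of c "- b"] by (simp add: algebra_simps power2_eq_square)
    ultimately show ?thesis
      by (simp add: zero_le_mult_iff)
  qed
  then show ?thesis
    by (simp add: abc)
qed

text \<open>Cauchy-Schwarz against the test vector \<open>S *v x\<close> bounds the fourth power of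
  its norm by a multiple of the form at \<open>x\<close>.\<close>

lemma psd_form_eq_0_iff:
  assumes "psd S"
  shows "x \<bullet> (S *v x) = 0 \<longleftrightarrow> S *v x = 0"
  using psd_Cauchy_Schwarz[OF assms, of "S *v x" x] by auto

lemma inner_axis_matrix_vector_axis:
  fixes S :: "real^'k^'k"
  shows "axis h 1 \<bullet> (S *v axis l 1) = S $ h $ l"
  by (simp add: inner_axis' matrix_vector_mult_basis column_def)

lemma psd_entry_le: "psd S \<Longrightarrow> (S $ h $ l)\<^sup>2 \<le> S $ h $ h * S $ l $ l"
  using psd_Cauchy_Schwarz[of S "axis h 1" "axis l 1"]
  by (simp add: inner_axis_matrix_vector_axis)

lemma psd_diag_nonneg: "psd S \<Longrightarrow> 0 \<le> S $ h $ h"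
  by (metis inner_axis_matrix_vector_axis psd_def)

lemma psd_add: "psd S \<Longrightarrow> psd T \<Longrightarrow> psd (S + T)"
  by (simp add: psd_def matrix_vector_mult_add_rdistrib inner_right_distrib transpose_def vec_eq_iff)

lemma scaleR_matrix_vector: "(a *\<^sub>R S) *v x = a *\<^sub>R ((S :: real^'n^'m) *v x)"
  by (simp add: matrix_vector_mult_def vec_eq_iff sum_distrib_left mult.assoc)

lemma psd_scaleR: "psd S \<Longrightarrow> 0 \<le> a \<Longrightarrow> psd (a *\<^sub>R S)"
  by (simp add: psd_def scaleR_matrix_vector transpose_def vec_eq_iff)

text \<open>For a symmetric matrix the orthogonal complement of the range is the kernel.\<close>

lemma psd_range_decomp:
  assumes "psd S"
  obtains w z where "x = S *v w + z" "S *v z = 0"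
proof -
  obtain y z where yz: "y \<in> span (range ((*v) S))" "\<And>w. w \<in> span (range ((*v) S)) \<Longrightarrow> orthogonal z w" "x = y + z"
    using orthogonal_subspace_decomp_exists[of "range ((*v) S)" x] by blast
  have "z \<bullet> (S *v (S *v z)) = 0"
    using yz(2)[of "S *v (S *v z)"] by (simp add: span_base orthogonal_def)
  then have "S *v z = 0"
    using psd_inner_sym[OF assms, of z "S *v z"] by simp
  moreover have "y \<in> range ((*v) S)"
    using yz(1) by (simp add: span_eq_iff[THEN iffD2] linear_subspace_image)
  ultimately show ?thesis
    using yz(3) that by auto
qed

text \<open>By symmetry the inclusion of kernels dualizes to an inclusion of the range of
  \<open>S\<close> in the range of \<open>U\<close>. The rank bound makes the ranges equal, and then
  so are their orthogonal complements, the kernels.\<close>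

lemma psd_kernel_eq_of_rank_le:
  assumes S: "psd S" and U: "psd U"
    and ker: "\<And>x. U *v x = 0 \<Longrightarrow> S *v x = 0" and rank: "rank U \<le> rank S"
    and x: "S *v x = 0"
  shows "U *v x = 0"
proof -
  have "range ((*v) S) \<subseteq> range ((*v) U)"
  proof safe
    fix u
    obtain w z where wz: "S *v u = U *v w + z" "U *v z = 0"
      by (rule psd_range_decomp[OF U])
    have "z \<bullet> (S *v u) = 0" "z \<bullet> (U *v w) = 0"
      using psd_inner_sym[OF S, of z u] ker[OF wz(2)] psd_inner_sym[OF U, of z w] wz(2) by simp_all
    then have "z = 0"
      using wz(1) by (simp add: inner_add_right)
    then show "S *v u \<in> range ((*v) U)"
      using wz(1) by simp
  qed
  then have "range ((*v) S) = range ((*v) U)"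
    using rank by (intro subspace_dim_equal) (auto simp: rank_dim_range linear_subspace_image)
  then obtain u where u: "U *v (U *v x) = S *v u"
    by blast
  have "(U *v x) \<bullet> (U *v x) = x \<bullet> (S *v u)"
    using psd_inner_sym[OF U, of x "U *v x"] u by simp
  also have "\<dots> = 0"
    using psd_inner_sym[OF S, of x u] x by simp
  finally show ?thesis
    by simp
qed

text \<open>On the range of \<open>S\<close> the form of \<open>S\<close> is positive definite, so
  by compactness of the unit sphere it dominates a small multiple of the form of \<open>T\<close>;
  on the kernel of \<open>S\<close> both vanish. This is the step beyond \<open>S\<close>, away from
  \<open>T\<close>, that the criterion for relative interiors asks for.\<close>

lemma psd_extrapolate:
  assumes S: "psd S" and T: "psd T" and ker: "\<And>x. S *v x = 0 \<Longrightarrow> T *v x = 0"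
  shows "\<exists>e>1. psd ((1 - e) *\<^sub>R T + e *\<^sub>R S)"
proof -
  define K where "K = range ((*v) S) \<inter> sphere 0 1"
  have "compact K"
    unfolding K_def by (intro closed_Int_compact closed_subspace) (auto simp: linear_subspace_image)
  have cont: "continuous_on K (\<lambda>x. x \<bullet> (R *v x))" for R :: "real^'a^'a"
    by (intro continuous_intros linear_continuous_on) (simp add: linear_conv_bounded_linear[symmetric])
  obtain d where d: "0 < d" "\<And>x. x \<in> K \<Longrightarrow> d \<le> x \<bullet> (S *v x)"
  proof (cases "K = {}")
    case False
    obtain x where x: "x \<in> K" "\<And>y. y \<in> K \<Longrightarrow> x \<bullet> (S *v x) \<le> y \<bullet> (S *v y)"
      using continuous_attains_inf[OF \<open>compact K\<close> False cont] by blast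
    have "x \<bullet> (S *v x) \<noteq> 0"
    proof
      assume "x \<bullet> (S *v x) = 0"
      then have "S *v x = 0"
        by (simp add: psd_form_eq_0_iff[OF S])
      moreover obtain w where "x = S *v w"
        using x(1) by (auto simp: K_def)
      ultimately have "x \<bullet> x = 0"
        using psd_inner_sym[OF S, of x w] by simp
      then show False
        using x(1) by (simp add: K_def)
    qed
    then have "0 < x \<bullet> (S *v x)"
      using S by (simp add: psd_def order_less_le)
    then show ?thesis
      using x(2) that by blast
  \<comment> \<open>\<open>K\<close> is empty exactly when \<open>S = 0\<close>; any positive bound
    then serves.\<close>
  qed (auto intro: that[of 1])
  obtain B where B: "\<And>x. x \<in> K \<Longrightarrow> x \<bullet> (T *v x) \<le> B"
    using compact_imp_bounded[OF compact_continuous_image[OF cont \<open>compact K\<close>], of T]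
    unfolding bounded_iff by (auto dest: abs_le_D1)
  \<comment> \<open>The summand 1 keeps the denominator positive even if
    \<open>B = 0\<close>.\<close>
  define t where "t = d / (\<bar>B\<bar> + 1)"
  have "0 < t"
    using d(1) by (simp add: t_def)
  have range: "t * (x \<bullet> (T *v x)) \<le> x \<bullet> (S *v x)" if x: "x \<in> range ((*v) S)" for x
  proof (cases "x = 0")
    case False
    define u where "u = x /\<^sub>R norm x"
    have "u \<in> K"
      using x False by (auto simp: K_def u_def simp flip: matrix_vector_mult_scaleR)
    have "t * (u \<bullet> (T *v u)) \<le> t * (\<bar>B\<bar> + 1)"
      using B[OF \<open>u \<in> K\<close>] \<open>0 < t\<close> by (intro mult_left_mono) auto
    also have "\<dots> \<le> u \<bullet> (S *v u)"
      using d(2)[OF \<open>u \<in> K\<close>] by (simp add: t_def)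
    finally have "(norm x)\<^sup>2 * (t * (u \<bullet> (T *v u))) \<le> (norm x)\<^sup>2 * (u \<bullet> (S *v u))"
      by (intro mult_left_mono) auto
    moreover have "(norm x)\<^sup>2 * (u \<bullet> (R *v u)) = x \<bullet> (R *v x)" for R :: "real^'a^'a"
      using False by (simp add: u_def matrix_vector_mult_scaleR power2_eq_square field_simps)
    ultimately show ?thesis
      by (simp add: mult.left_commute)
  qed simp
  have "0 \<le> x \<bullet> ((- t *\<^sub>R T + (1 + t) *\<^sub>R S) *v x)" for x
  proof -
    obtain w z where wz: "x = S *v w + z" "S *v z = 0"
      by (rule psd_range_decomp[OF S])
    \<comment> \<open>The kernel component \<open>z\<close> drops out of the forms of both
      matrices.\<close>
    have form: "x \<bullet> (R *v x) = (S *v w) \<bullet> (R *v (S *v w))" if "psd R" "R *v z = 0" for R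
      using psd_inner_sym[OF that(1), of z "S *v w"] that(2)
      by (simp add: wz(1) matrix_vector_right_distrib inner_add_left)
    have "t * (x \<bullet> (T *v x)) \<le> x \<bullet> (S *v x)"
      using range[of "S *v w"] form[OF S wz(2)] form[OF T ker[OF wz(2)]] by simp
    also have "\<dots> \<le> (1 + t) * (x \<bullet> (S *v x))"
      using S \<open>0 < t\<close> by (simp add: psd_def algebra_simps)
    finally show ?thesis
      by (simp add: matrix_vector_mult_diff_rdistrib scaleR_matrix_vector inner_diff_right)
  qed
  moreover have "transpose (- t *\<^sub>R T + (1 + t) *\<^sub>R S) = - t *\<^sub>R T + (1 + t) *\<^sub>R S"
    using psd_sym[OF S] psd_sym[OF T] by (simp add: transpose_def vec_eq_iff)
  ultimately have "psd ((1 - (1 + t)) *\<^sub>R T + (1 + t) *\<^sub>R S)"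
    by (simp add: psd_def)
  then show ?thesis
    using \<open>0 < t\<close> by (intro exI[of _ "1 + t"]) auto
qed

section \<open>Arrow matrices, their adjoint and the Lorentz cones\<close>

context block_structure
begin

text \<open>\<open>d\<close>, read at the heads, gives the diagonal and \<open>w\<close> the border.
  They are separate because the data matrices weight them differently; the matrix DArw of a vector
  \<open>x\<close> is \<open>arrow x x\<close>.\<close>

definition arrow :: "'k rvec \<Rightarrow> 'k rvec \<Rightarrow> ('k, 'k) rmat"
  where "arrow d w = (\<chi> h l. if head h \<noteq> head l then 0 else if h = l then d $ head h
     else if h = head h then w $ l else if l = head l then w $ h else 0)"

text \<open>The adjoint of x -> \<open>arrow x x\<close> for the trace pairing. On symmetric
  matrices it collects the block traces and twice the border entries, so
  \<open>contract S = s\<close> encodes the linear conditions of admissibility.\<close>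

definition contract :: "('k, 'k) rmat \<Rightarrow> 'k rvec"
  where "contract S = (\<chi> h. if h = head h then \<Sum>l\<in>block h. S $ l $ l
     else S $ h $ head h + S $ head h $ h)"

lemma linear_contract: "linear contract"
  by (rule linearI) (simp_all add: contract_def vec_eq_iff sum.distrib sum_distrib_left algebra_simps)

lemma DArw_eq_arrow:
  "DArw n f = arrow (\<chi> h. f (Cf n h) 1) (\<chi> h. f (Cf n h) (pos h - off n (Cf n h - 1)))"
proof -
  have "DArw n f $ h $ l = arrow (\<chi> h. f (Cf n h) 1) (\<chi> h. f (Cf n h) (pos h - off n (Cf n h - 1))) $ h $ l"
    for h l :: 'k
  proof (cases "Cf n h = Cf n l")
    case True
    then have "pos h - off n (Cf n h - 1) = pos l - off n (Cf n h - 1) \<longleftrightarrow> h = l"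
      using Cf_props(2)[of h] Cf_props(2)[of l] pos_eq_iff[of h l] by auto
    moreover have "pos l - off n (Cf n h - 1) = 1 \<longleftrightarrow> l = head l"
      and "pos h - off n (Cf n h - 1) = 1 \<longleftrightarrow> h = head h"
      using index_eq_1_iff[of l] index_eq_1_iff[of h] True by simp_all
    moreover have "head h = head l"
      using True by (simp add: head_eq_iff)
    ultimately show ?thesis
      using True by (simp add: DArw_def arrow_def arw_def Cf_head)
  qed (simp add: DArw_def arrow_def head_eq_iff)
  then show ?thesis
    by (simp add: vec_eq_iff)
qed

lemma DArw_blk: "DArw n (blk n x) = arrow x x"
  using blk_self[of x] by (simp add: DArw_eq_arrow blk_head) (simp add: arrow_def vec_eq_iff)

text \<open>The data matrices in arrow form. The weights undo the multiplicities in
  \<open>contract\<close>, which sums one diagonal entry per index of the block and counts each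
  border entry twice; hence this map is a right inverse of \<open>contract\<close>.\<close>

definition arrow_half :: "'k rvec \<Rightarrow> ('k, 'k) rmat"
  where "arrow_half a = arrow (\<chi> h. a $ head h / card (block (head h))) (a /\<^sub>R 2)"

lemma DArw_wt: "DArw n (wt n (blk n a)) = arrow_half a"
proof -
  have "wt n (blk n a) (Cf n h) (pos h - off n (Cf n h - 1)) = a $ h / 2" if "h \<noteq> head h" for h :: 'k
    using blk_self[of a h] index_eq_1_iff[of h] that by (simp add: wt_def)
  moreover have "wt n (blk n a) (Cf n h) 1 = a $ head h / card (block (head h))" for h :: 'k
    by (simp add: wt_def blk_head card_block)
  ultimately show ?thesis
    unfolding DArw_eq_arrow arrow_half_def by (simp add: arrow_def vec_eq_iff)
qed

lemma sum_heads: "(\<Sum>h\<in>UNIV. g h) = (\<Sum>p | head p = p. \<Sum>h\<in>block p. g h)"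
  using sum.group[of UNIV "{p. head p = p}" head g] by (simp add: image_subset_iff block_def)

lemma trace_arrow:
  "trace (arrow d w ** X) = (\<Sum>h\<in>UNIV. (if h = head h then d $ h else w $ h) * contract X $ h)"
proof -
  \<comment> \<open>Diagonal, head column and head row are separated; the nested conditionals let
    each double sum collapse by \<open>sum.delta\<close>.\<close>
  have entry: "arrow d w $ h $ l * X $ l $ h = (if l = h then d $ head h * X $ h $ h else 0)
      + (if l = head h then if h \<noteq> head h then w $ h * X $ head h $ h else 0 else 0)
      + (if h = head l then if l \<noteq> head l then w $ l * X $ l $ head l else 0 else 0)" for h l
    by (auto simp: arrow_def)
  have "trace (arrow d w ** X) = (\<Sum>h\<in>UNIV. \<Sum>l\<in>UNIV. arrow d w $ h $ l * X $ l $ h)"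
    by (simp add: trace_def matrix_matrix_mult_def)
  also have "\<dots> = (\<Sum>h\<in>UNIV. d $ head h * X $ h $ h)
      + (\<Sum>h\<in>UNIV. if h \<noteq> head h then w $ h * X $ head h $ h else 0)
      + (\<Sum>h\<in>UNIV. \<Sum>l\<in>UNIV. if h = head l then if l \<noteq> head l then w $ l * X $ l $ head l else 0 else 0)"
    unfolding entry by (simp only: sum.distrib sum.delta finite_class.finite_UNIV UNIV_I if_True)
  also have "(\<Sum>h\<in>UNIV. \<Sum>l\<in>UNIV. if h = head l then if l \<noteq> head l then w $ l * X $ l $ head l else 0 else 0)
      = (\<Sum>l\<in>UNIV. if l \<noteq> head l then w $ l * X $ l $ head l else 0)"
    by (subst sum.swap) (simp only: sum.delta finite_class.finite_UNIV UNIV_I if_True)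
  also have "(\<Sum>h\<in>UNIV. d $ head h * X $ h $ h) = (\<Sum>p | head p = p. d $ p * contract X $ p)"
    by (subst sum_heads) (auto intro!: sum.cong simp: contract_def sum_distrib_left block_def)
  also have "\<dots> = (\<Sum>h\<in>UNIV. if h = head h then d $ h * contract X $ h else 0)"
    by (intro sum.mono_neutral_cong_left) auto
  finally show ?thesis
    by (simp add: sum.distrib[symmetric]) (auto intro!: sum.cong simp: contract_def algebra_simps)
qed

lemma trace_arrow_diag: "trace (arrow x x ** X) = x \<bullet> contract X"
  by (simp add: trace_arrow inner_vec_def)

lemma contract_arrow: "contract (arrow d w) $ h = (if h = head h then card (block h) * d $ h else 2 * w $ h)"
  by (auto simp: contract_def arrow_def block_def)

lemma block_nonempty: "h = head h \<Longrightarrow> block h \<noteq> {}"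
  unfolding block_def by (metis (mono_tags) empty_iff mem_Collect_eq)

lemma contract_arrow_half: "contract (arrow_half a) = a"
  by (auto simp: vec_eq_iff arrow_half_def contract_arrow dest: block_nonempty)

lemma trace_arrow_half: "trace (arrow_half a ** arrow x x) = a \<bullet> x"
  unfolding arrow_half_def trace_arrow inner_vec_def contract_arrow
  by (intro sum.cong) (auto dest: block_nonempty)

text \<open>The 2 x 2 minors through the head bound each squared border entry by a product of
  diagonal entries. Summing them and using 4ab \<le> (a + b)^2 bounds the border by the block
  trace.\<close>

lemma psd_contract_in_lorentz:
  assumes "psd S"
  shows "contract S \<in> lorentz_prod r n"
  unfolding lorentz_prod_iff
proof safe
  fix p assume p: "head p = p"
  define B where "B = block p - {p}"
  define t where "t = (\<Sum>h\<in>B. S $ h $ h)"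
  have t: "0 \<le> t" "0 \<le> S $ p $ p"
    using psd_diag_nonneg[OF assms] by (auto simp: t_def intro: sum_nonneg)
  have "block p = insert p B" "p \<notin> B"
    using p by (auto simp: B_def block_def)
  then have head: "contract S $ p = S $ p $ p + t"
    using p by (simp add: contract_def t_def)
  have "(\<Sum>h\<in>B. (contract S $ h)\<^sup>2) = (\<Sum>h\<in>B. 4 * (S $ p $ h)\<^sup>2)"
    using psd_sym[OF assms] by (intro sum.cong) (auto simp: contract_def B_def block_def power2_eq_square)
  also have "\<dots> \<le> (\<Sum>h\<in>B. 4 * (S $ p $ p * S $ h $ h))"
    by (intro sum_mono mult_left_mono psd_entry_le assms) auto
  also have "\<dots> = 4 * (S $ p $ p * t)"
    by (simp add: t_def sum_distrib_left)
  also have "\<dots> \<le> (S $ p $ p + t)\<^sup>2"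
    using zero_le_power2[of "S $ p $ p - t"] by (simp add: power2_eq_square algebra_simps)
  finally show "L2_set (($) (contract S)) (block p - {p}) \<le> contract S $ p"
    using t head by (auto simp: L2_set_def B_def[symmetric] intro: real_le_lsqrt)
qed

text \<open>Half of the self-duality of the cone: in each block Cauchy-Schwarz bounds the border
  part by the product of the heads.\<close>

lemma lorentz_inner_nonneg:
  fixes x s :: "'k rvec"
  assumes "x \<in> lorentz_prod r n" "s \<in> lorentz_prod r n"
  shows "0 \<le> x \<bullet> s"
proof -
  have "0 \<le> (\<Sum>h\<in>block p. x $ h * s $ h)" if p: "head p = p" for p
  proof -
    define B where "B = block p - {p}"
    have xs: "L2_set (($) x) B \<le> x $ p" "L2_set (($) s) B \<le> s $ p"
      using assms p by (auto simp: lorentz_prod_iff B_def)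
    have "\<bar>\<Sum>h\<in>B. x $ h * s $ h\<bar> \<le> (\<Sum>h\<in>B. \<bar>x $ h\<bar> * \<bar>s $ h\<bar>)"
      using sum_abs[of "\<lambda>h. x $ h * s $ h" B] by (simp add: abs_mult)
    also have "\<dots> \<le> L2_set (($) x) B * L2_set (($) s) B"
      by (rule L2_set_mult_ineq)
    also have "\<dots> \<le> x $ p * s $ p"
      using xs by (intro mult_mono) (auto intro: order_trans[OF L2_set_nonneg])
    finally have "0 \<le> x $ p * s $ p + (\<Sum>h\<in>B. x $ h * s $ h)"
      by linarith
    moreover have "block p = insert p B" "p \<notin> B"
      using p by (auto simp: B_def block_def)
    ultimately show ?thesis
      by simp
  qed
  then have "0 \<le> (\<Sum>p | head p = p. \<Sum>h\<in>block p. x $ h * s $ h)"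
    by (rule sum_nonneg) simp
  then show ?thesis
    by (simp add: inner_vec_def sum_heads)
qed

text \<open>Rank one matrices turn the form of \<open>arrow x x\<close> at \<open>y\<close> into the
  inner product of \<open>x\<close> with \<open>contract (outer y)\<close>, a point of the
  cone.\<close>

definition outer :: "'k rvec \<Rightarrow> ('k, 'k) rmat"
  where "outer y = (\<chi> h l. y $ h * y $ l)"

lemma inner_outer: "z \<bullet> (outer y *v z) = (y \<bullet> z)\<^sup>2"
  by (simp add: outer_def matrix_vector_mult_def inner_vec_def power2_eq_square sum_product
      sum_distrib_left mult_ac)

lemma psd_outer: "psd (outer y)"
  by (simp add: psd_def inner_outer) (simp add: outer_def transpose_def vec_eq_iff)

lemma arrow_form: "y \<bullet> (arrow x x *v y) = x \<bullet> contract (outer y)"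
proof -
  have "y \<bullet> (arrow x x *v y) = trace (arrow x x ** outer y)"
    by (simp add: trace_def matrix_matrix_mult_def outer_def matrix_vector_mult_def inner_vec_def
        sum_distrib_left mult_ac)
  then show ?thesis
    by (simp add: trace_arrow_diag)
qed

lemma transpose_arrow: "transpose (arrow d w) = arrow d w"
  by (auto simp: transpose_def arrow_def vec_eq_iff)

text \<open>For \<open>x\<close> in the cone the form is an inner product of two cone points, hence
  nonnegative. Conversely, each block inequality comes from evaluating the form at one test
  vector.\<close>

lemma psd_arrow_iff: "psd (arrow x x) \<longleftrightarrow> x \<in> lorentz_prod r n"
proof
  assume "x \<in> lorentz_prod r n"
  then show "psd (arrow x x)"
    by (auto simp: psd_def transpose_arrow arrow_form intro: lorentz_inner_nonneg psd_contract_in_lorentz psd_outer)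
next
  assume psd: "psd (arrow x x)"
  show "x \<in> lorentz_prod r n"
    unfolding lorentz_prod_iff
  proof safe
    fix p assume p: "head p = p"
    define B t where "B = block p - {p}" and "t = L2_set (($) x) B"
    have B: "block p = insert p B" "p \<notin> B" "\<And>h. h \<in> B \<Longrightarrow> head h = p"
      using p by (auto simp: B_def block_def)
    show "t \<le> x $ p"
    proof (cases "t = 0")
      \<comment> \<open>The test vector used for \<open>t > 0\<close> would be zero here, so the
        diagonal entry is used instead.\<close>
      case True
      then show ?thesis
        using psd_diag_nonneg[OF psd, of p] p by (simp add: arrow_def)
    next
      case False
      then have "0 < t"
        by (simp add: t_def order_less_le)
      have t2: "(\<Sum>h\<in>B. (x $ h)\<^sup>2) = t\<^sup>2"
        by (simp add: t_def L2_set_def sum_nonneg)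
      \<comment> \<open>At this vector the head contributes 2 t^2 x_p and each border index - 2 t
        x_h^2, so the form equals 2 t^2 (x_p - t).\<close>
      define y where "y = (\<chi> h. if h = p then t else if h \<in> B then - x $ h else 0)"
      have "x $ h * contract (outer y) $ h = (if h = p then x $ p * (t\<^sup>2 + t\<^sup>2) else 0)
          + (if h \<in> B then - 2 * t * (x $ h)\<^sup>2 else 0)" for h
      proof -
        have "(\<Sum>l\<in>B. y $ l * y $ l) = t\<^sup>2"
          unfolding t2[symmetric] using B(2) by (intro sum.cong) (auto simp: y_def power2_eq_square)
        then have pblock: "(\<Sum>l\<in>block p. y $ l * y $ l) = t\<^sup>2 + t\<^sup>2"
          using B(1,2) by (simp add: y_def power2_eq_square)
        have zero: "(\<Sum>l\<in>block h. y $ l * y $ l) = 0" if "h \<noteq> p"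
          using that B(3) p by (intro sum.neutral) (auto simp: y_def block_def)
        consider "h = p" | "h \<in> B" "h \<noteq> p" | "h \<notin> B" "h \<noteq> p"
          by blast
        then show ?thesis
        proof cases
          case 2
          then have "head h = p" "y $ h = - x $ h" "y $ p = t"
            using B(3) by (auto simp: y_def)
          then show ?thesis
            using 2 by (simp add: contract_def outer_def power2_eq_square)
        next
          case 3
          then have "y $ h = 0"
            by (simp add: y_def)
          then show ?thesis
            using 3 zero by (simp add: contract_def outer_def)
        qed (use p B(2) pblock in \<open>simp add: contract_def outer_def\<close>)
      qed
      moreover have "(\<Sum>h\<in>B. - 2 * t * (x $ h)\<^sup>2) = - 2 * t * t\<^sup>2"
        unfolding t2[symmetric] by (simp only: sum_distrib_left)
      ultimately have "x \<bullet> contract (outer y) = 2 * t\<^sup>2 * x $ p - 2 * t * t\<^sup>2"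
        by (simp add: inner_vec_def sum.distrib sum.If_cases)
      moreover have "0 \<le> x \<bullet> contract (outer y)"
        using psd by (simp add: psd_def flip: arrow_form)
      ultimately have "0 \<le> 2 * t\<^sup>2 * (x $ p - t)"
        by (simp add: algebra_simps)
      then show ?thesis
        using \<open>0 < t\<close> by (simp add: zero_le_mult_iff)
    qed
  qed
qed

end

section \<open>Optimal sets as level sets, and the dual equality constraint\<close>

lemma is_arg_max_Collect_eq:
  fixes f :: "'a \<Rightarrow> 'b::linorder"
  assumes "is_arg_max f P a"
  shows "{x. is_arg_max f P x} = {x. P x \<and> f x = f a}"
  using assms by (auto simp: is_arg_max_def not_less intro: antisym)

lemma linear_sum_constraint: "linear (\<lambda>(y, v, z, S). (\<Sum>j\<in>UNIV. y $ j *\<^sub>R (F j :: real^'k^'k))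
    + (\<Sum>(h, l)\<in>I. (v :: real^'k^'k) $ h $ l *\<^sub>R G h l) + (\<Sum>k\<in>K. z $ k *\<^sub>R H k) + S)"
  by (rule linearI)
    (auto simp: case_prod_beta scaleR_add_left scaleR_add_right sum.distrib scaleR_sum_right)

text \<open>The weights may be negative, as needed for extrapolation with \<open>1 - e < 0\<close>;
  only semidefiniteness requires separate care there.\<close>

lemma affine_constraint_D_SDO:
  assumes "supp_vz n (fst (snd d)) (fst (snd (snd d)))" "D_SDO_eq n A c d"
    and "supp_vz n (fst (snd d')) (fst (snd (snd d')))" "D_SDO_eq n A c d'"
    and "u + w = 1"
  shows "supp_vz n (fst (snd (u *\<^sub>R d + w *\<^sub>R d'))) (fst (snd (snd (u *\<^sub>R d + w *\<^sub>R d'))))"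
    and "D_SDO_eq n A c (u *\<^sub>R d + w *\<^sub>R d')"
proof -
  define G :: "('a, 'b) sdo_dual \<Rightarrow> ('a, 'a) rmat" where
    "G = (\<lambda>(y, v, z, S). (\<Sum>j\<in>UNIV. y $ j *\<^sub>R A_til n A j) + (\<Sum>(h, l)\<in>Iset n. v $ h $ l *\<^sub>R A_check h l)
       + (\<Sum>k\<in>Kset n. z $ k *\<^sub>R A_hat n k) + S)"
  have "linear G"
    unfolding G_def by (rule linear_sum_constraint)
  have G: "D_SDO_eq n A c e \<longleftrightarrow> G e = C_til n c" for e
    by (simp add: D_SDO_eq_def G_def case_prod_beta)
  have "G (u *\<^sub>R d + w *\<^sub>R d') = (u + w) *\<^sub>R C_til n c"
    using assms(2,4)
    by (simp add: G linear_add[OF \<open>linear G\<close>] linear_scale[OF \<open>linear G\<close>] scaleR_add_left)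
  then show "D_SDO_eq n A c (u *\<^sub>R d + w *\<^sub>R d')"
    by (simp add: G assms)
qed (use assms in \<open>simp add: supp_vz_def\<close>)

lemma trace_A_check: "h \<noteq> l \<Longrightarrow> trace (A_check h l ** X) = X $ l $ h + X $ h $ l"
proof -
  assume "h \<noteq> l"
  then have "A_check h l $ p $ q * X $ q $ p = (if q = l then if p = h then X $ l $ h else 0 else 0)
      + (if q = h then if p = l then X $ h $ l else 0 else 0)" for p q
    by (auto simp: A_check_def)
  then show ?thesis
    by (simp add: trace_def matrix_matrix_mult_def sum.distrib)
qed

section \<open>The primal SDO problem as the arrow image of the SOCO problem\<close>

context block_structure
begin

lemma A_til_eq: "A_til n A j = arrow_half (A $ j)"
  by (simp add: A_til_def DArw_wt)

lemma C_til_eq: "C_til n c = arrow_half c"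
  by (simp add: C_til_def DArw_wt)

lemma trace_A_hat:
  assumes "k \<noteq> head k"
  shows "trace (A_hat n k ** X) = X $ head k $ head k - X $ k $ k"
proof -
  have "A_hat n k $ p $ q * X $ q $ p = (if q = head k then if p = head k then X $ head k $ head k else 0 else 0)
      - (if q = k then if p = k then X $ k $ k else 0 else 0)" for p q
    using assms by (auto simp: A_hat_eq)
  then show ?thesis
    by (simp add: trace_def matrix_matrix_mult_def sum_subtractf)
qed

lemma linear_arrow: "linear (\<lambda>x. arrow x x)"
  by (rule linearI) (simp_all add: arrow_def vec_eq_iff)

lemma inj_arrow: "inj (\<lambda>x. arrow x x)"
proof (rule injI)
  fix x y assume "arrow x x = arrow y y"
  then have "contract (arrow x x) $ h = contract (arrow y y) $ h" for h
    by simp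
  then have "x $ h = y $ h" for h
    using block_nonempty[of h] by (cases "h = head h") (auto simp: contract_arrow dest: meta_spec[of _ h])
  then show "x = y"
    by (simp add: vec_eq_iff)
qed

text \<open>The constraints over \<open>Iset n\<close> erase all entries outside the arrow pattern
  and those over \<open>Kset n\<close> equalize the diagonal within each block. What remains is an
  arrow matrix, for which semidefiniteness is membership in the cone.\<close>

lemma P_SDO_iff: "P_SDO n A b X \<longleftrightarrow> (\<exists>x. P_SOCO r n A b x \<and> X = arrow x x)"
proof
  assume X: "P_SDO n A b X"
  then have psd: "psd X"
    by (simp add: P_SDO_def)
  define x where "x = (\<chi> h. if h = head h then X $ h $ h else X $ h $ head h)"
  have I: "X $ h $ l = 0" if "(h, l) \<in> Iset n" for h l
    using X that trace_A_check[of h l X] psd_sym[OF psd, of h l] by (auto simp: P_SDO_def Iset_def)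
  have K: "X $ h $ h = X $ head h $ head h" for h
    using X trace_A_hat[of h X] by (cases "h = head h") (auto simp: P_SDO_def Kset_eq)
  have zero: "X $ h $ l = 0" if "h \<noteq> l" "head h \<noteq> head l \<or> h \<noteq> head h \<and> l \<noteq> head l" for h l
  proof -
    \<comment> \<open>Only one order of each pair is listed in \<open>Iset n\<close>; symmetry of
      \<open>X\<close> covers the other.\<close>
    have "(h, l) \<in> Iset n \<or> (l, h) \<in> Iset n"
      unfolding Iset_eq mem_Collect_eq prod.case using that by (metis linorder_neqE)
    then show ?thesis
      using I[of h l] I[of l h] psd_sym[OF psd, of h l] by auto
  qed
  have "X $ h $ l = arrow x x $ h $ l" for h l
    using zero[of h l] K[of h] psd_sym[OF psd, of h l] unfolding arrow_def x_def
    by (cases "h = l") simp_all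
  then have "X = arrow x x"
    by (simp add: vec_eq_iff)
  moreover have "A *v x = b"
    using X by (simp add: P_SDO_def \<open>X = arrow x x\<close> A_til_eq trace_arrow_half vec_eq_iff
        matrix_vector_mult_def inner_vec_def)
  ultimately show "\<exists>x. P_SOCO r n A b x \<and> X = arrow x x"
    using psd psd_arrow_iff by (auto simp: P_SOCO_def)
next
  assume "\<exists>x. P_SOCO r n A b x \<and> X = arrow x x"
  then obtain x where x: "A *v x = b" "x \<in> lorentz_prod r n" "X = arrow x x"
    by (auto simp: P_SOCO_def)
  have "trace (A_check h l ** X) = 0" if "(h, l) \<in> Iset n" for h l
  proof -
    have "h \<noteq> l" "head h \<noteq> head l \<or> h \<noteq> head h \<and> l \<noteq> head l"
      using that head_le[of h] by (auto simp: Iset_eq)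
    moreover from this have "arrow x x $ l $ h = 0" "arrow x x $ h $ l = 0"
      by (auto simp: arrow_def)
    ultimately show ?thesis
      by (simp add: trace_A_check x(3))
  qed
  moreover have "trace (A_hat n k ** X) = 0" if "k \<in> Kset n" for k
  proof -
    have "k \<noteq> head k"
      using that by (simp add: Kset_eq)
    then show ?thesis
      by (simp add: trace_A_hat x(3)) (simp add: arrow_def)
  qed
  moreover have "trace (A_til n A j ** X) = b $ j" for j
    by (simp add: A_til_eq x(3) trace_arrow_half)
      (simp add: x(1)[symmetric] matrix_vector_mult_def inner_vec_def)
  ultimately show "P_SDO n A b X"
    using x(2,3) psd_arrow_iff by (auto simp: P_SDO_def)
qed

lemma P_SDO_opt_eq: "P_SDO_opt n A b c = (\<lambda>x. arrow x x) ` P_SOCO_opt r n A b c"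
proof -
  have "is_arg_min (\<lambda>X. trace (C_til n c ** X)) (P_SDO n A b) (arrow x x) \<longleftrightarrow>
      is_arg_min (\<lambda>x. c \<bullet> x) (P_SOCO r n A b) x" for x
    unfolding is_arg_min_def P_SDO_iff C_til_eq
    using injD[OF inj_arrow] by (fastforce simp: trace_arrow_half)
  moreover have "P_SDO n A b X" if "is_arg_min (\<lambda>X. trace (C_til n c ** X)) (P_SDO n A b) X" for X
    using that by (simp add: is_arg_min_def)
  ultimately show ?thesis
    unfolding P_SDO_opt_def P_SOCO_opt_def P_SDO_iff by blast
qed

section \<open>Contracting dual SDO points to dual SOCO points\<close>

lemma contract_A_check: "(h, l) \<in> Iset n \<Longrightarrow> contract (A_check h l) = 0"
proof -
  assume "(h, l) \<in> Iset n"
  then have *: "h < l" "head h = head l \<Longrightarrow> h \<noteq> head h"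
    by (auto simp: Iset_eq)
  have "l \<noteq> head h"
    using *(1) head_le[of h] by auto
  moreover have "h \<noteq> head l"
    using *(2) by fastforce
  ultimately show ?thesis
    using *(1) by (auto simp: contract_def A_check_def vec_eq_iff intro!: sum.neutral)
qed

lemma contract_A_hat: "k \<in> Kset n \<Longrightarrow> contract (A_hat n k) = 0"
proof -
  assume "k \<in> Kset n"
  then have k: "k \<noteq> head k"
    by (simp add: Kset_eq)
  have "A_hat n k $ l $ l = (if l = head k then 1 else 0) - (if l = k then 1 else 0)" for l
    using k by (auto simp: A_hat_eq)
  then have "(\<Sum>l\<in>block h. A_hat n k $ l $ l) = 0" if "h = head h" for h
    using that by (auto simp: sum_subtractf block_def)
  moreover have "A_hat n k $ h $ l = 0" if "h \<noteq> l" for h l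
    using that by (auto simp: A_hat_eq)
  ultimately show ?thesis
    by (auto simp: contract_def vec_eq_iff)
qed

text \<open>\<open>contract\<close> annihilates the terms with \<open>v\<close> and \<open>z\<close>
  and undoes \<open>arrow_half\<close>, so applying it to the SDO equality leaves the SOCO
  equality.\<close>

lemma D_SDO_eq_contract:
  assumes "D_SDO_eq n A c (y, v, z, S)"
  shows "transpose A *v y + contract S = c"
proof -
  have "contract (\<Sum>j\<in>UNIV. y $ j *\<^sub>R A_til n A j) = transpose A *v y"
    by (simp add: linear_sum[OF linear_contract] linear_scale[OF linear_contract] A_til_eq contract_arrow_half)
      (simp add: vec_eq_iff vector_matrix_mult_def mult.commute)
  moreover have "contract (\<Sum>(h, l)\<in>Iset n. v $ h $ l *\<^sub>R A_check h l) = 0"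
    by (auto simp: linear_sum[OF linear_contract] linear_scale[OF linear_contract] contract_A_check intro!: sum.neutral)
  moreover have "contract (\<Sum>k\<in>Kset n. z $ k *\<^sub>R A_hat n k) = 0"
    by (auto simp: linear_sum[OF linear_contract] linear_scale[OF linear_contract] contract_A_hat intro!: sum.neutral)
  moreover have "contract (\<Sum>j\<in>UNIV. y $ j *\<^sub>R A_til n A j) + contract (\<Sum>(h, l)\<in>Iset n. v $ h $ l *\<^sub>R A_check h l)
      + contract (\<Sum>k\<in>Kset n. z $ k *\<^sub>R A_hat n k) + contract S = contract (C_til n c)"
    using assms by (simp add: D_SDO_eq_def flip: linear_add[OF linear_contract])
  ultimately show ?thesis
    by (simp add: C_til_eq contract_arrow_half)
qed

lemma D_SDO_imp_D_SOCO: "D_SDO n A c (y, v, z, S) \<Longrightarrow> D_SOCO r n A c (y, contract S)"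
  using D_SDO_eq_contract[of A c y v z S] by (auto simp: D_SDO_def D_SOCO_def psd_contract_in_lorentz)

text \<open>Every feasible SDO point contracts to a feasible SOCO point with the same
  \<open>y\<close>, so the SOCO optimum bounds the SDO objective; the given point attains this
  bound.\<close>

lemma D_SDO_opt_iff:
  assumes "D_SDO n A c (y, v, z, S)" "(y, contract S) \<in> D_SOCO_opt r n A b c"
  shows "(y', v', z', S') \<in> D_SDO_opt n A b c \<longleftrightarrow> D_SDO n A c (y', v', z', S') \<and> b \<bullet> y' = b \<bullet> y"
proof -
  have "is_arg_max (\<lambda>(y, v, z, S). b \<bullet> y) (D_SDO n A c) (y, v, z, S)"
    using assms D_SDO_imp_D_SOCO by (fastforce simp: is_arg_max_def D_SOCO_opt_def)
  from is_arg_max_Collect_eq[OF this] show ?thesis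
    by (auto simp: D_SDO_opt_def)
qed

lemma D_SOCO_opt_eq:
  assumes "(y, s) \<in> D_SOCO_opt r n A b c"
  shows "D_SOCO_opt r n A b c = {(y', s'). D_SOCO r n A c (y', s') \<and> b \<bullet> y' = b \<bullet> y}"
  using is_arg_max_Collect_eq[of "\<lambda>(y, s). b \<bullet> y" "D_SOCO r n A c" "(y, s)"] assms
  by (auto simp: D_SOCO_opt_def)

lemma convex_D_SOCO_opt:
  fixes A :: "('k, 'm::finite) rmat"
  shows "convex (D_SOCO_opt r n A b c)"
proof (cases "D_SOCO_opt r n A b c = {}")
  case False
  then obtain y s where "(y, s) \<in> D_SOCO_opt r n A b c"
    by auto
  note opt = D_SOCO_opt_eq[OF this]
  show ?thesis
    unfolding opt
  proof (rule convexI)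
    fix d1 d2 :: "'m rvec \<times> 'k rvec" and u w :: real
    assume uw: "0 \<le> u" "0 \<le> w" "u + w = 1"
      and mem: "d1 \<in> {(y', s'). D_SOCO r n A c (y', s') \<and> b \<bullet> y' = b \<bullet> y}"
        "d2 \<in> {(y', s'). D_SOCO r n A c (y', s') \<and> b \<bullet> y' = b \<bullet> y}"
    obtain y1 s1 y2 s2 where d: "d1 = (y1, s1)" "d2 = (y2, s2)"
      by (metis prod.exhaust)
    then have b: "b \<bullet> y1 = b \<bullet> y" "b \<bullet> y2 = b \<bullet> y"
      and c1: "transpose A *v y1 + s1 = c" and c2: "transpose A *v y2 + s2 = c"
      and L: "s1 \<in> lorentz_prod r n" "s2 \<in> lorentz_prod r n"
      using mem by (simp_all add: D_SOCO_def)
    have "u *\<^sub>R (transpose A *v y1 + s1) + w *\<^sub>R (transpose A *v y2 + s2) = c"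
      unfolding c1 c2 using uw(3) by (simp flip: scaleR_add_left)
    then have c': "transpose A *v (u *\<^sub>R y1 + w *\<^sub>R y2) + (u *\<^sub>R s1 + w *\<^sub>R s2) = c"
      by (simp add: matrix_vector_right_distrib matrix_vector_mult_scaleR algebra_simps)
    \<comment> \<open>Convexity of the Lorentz cones is inherited from the semidefinite cone through
      \<open>psd_arrow_iff\<close>.\<close>
    have "psd (u *\<^sub>R arrow s1 s1 + w *\<^sub>R arrow s2 s2)"
      using L uw by (intro psd_add psd_scaleR) (auto simp: psd_arrow_iff)
    then have L': "u *\<^sub>R s1 + w *\<^sub>R s2 \<in> lorentz_prod r n"
      by (simp add: linear_add[OF linear_arrow] linear_scale[OF linear_arrow] flip: psd_arrow_iff)
    have "b \<bullet> (u *\<^sub>R y1 + w *\<^sub>R y2) = b \<bullet> y"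
      using uw(3) by (simp add: inner_add_right b flip: distrib_right)
    then show "u *\<^sub>R d1 + w *\<^sub>R d2 \<in> {(y', s'). D_SOCO r n A c (y', s') \<and> b \<bullet> y' = b \<bullet> y}"
      using c' L' by (simp add: D_SOCO_def d)
  qed
qed simp

section \<open>Admissible slacks, maximal rank and block diagonal parts\<close>

lemma admissible_slack_iff:
  "admissible_slack r n s S \<longleftrightarrow> psd S \<and> (\<forall>h l. head h \<noteq> head l \<longrightarrow> S $ h $ l = 0) \<and> contract S = s"
proof (cases "psd S")
  case True
  have eq: "(\<Sum>j = ublk n i..ublk n i + n i - 1. S $ ix j $ ix j) = blk n s i 1
      \<and> (\<forall>j\<in>{2..n i}. S $ ix (ublk n i) $ ix (ublk n i + j - 1) = blk n s i j / 2)
      \<longleftrightarrow> (\<forall>h\<in>block p. contract S $ h = s $ h)" if p: "head p = p" "i = Cf n p" for p i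
  proof -
    have "(\<Sum>j = ublk n i..ublk n i + n i - 1. S $ ix j $ ix j)
        = (\<Sum>j = 1..n i. S $ ix (ublk n i + j - 1) $ ix (ublk n i + j - 1))"
      using n_pos[OF Cf_props(1)[of p]] p
      by (intro sum.reindex_bij_witness[of _ "\<lambda>j. ublk n i + j - 1" "\<lambda>j. j + 1 - ublk n i"]) auto
    also have "\<dots> = (\<Sum>l\<in>block p. S $ l $ l)"
      by (subst block_pos_image(1)[OF p(1)], subst sum.reindex[OF block_pos_image(3)[OF p(1)]]) (simp add: p(2))
    finally have tr: "(\<Sum>j = ublk n i..ublk n i + n i - 1. S $ ix j $ ix j) = contract S $ p"
      using p by (simp add: contract_def)
    have hd: "ix (ublk n i) = p" "blk n s i 1 = s $ p"
      using head_eq[of p] blk_head[of s p] p by simp_all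
    have "(\<forall>j\<in>{2..n i}. S $ ix (ublk n i) $ ix (ublk n i + j - 1) = blk n s i j / 2)
        \<longleftrightarrow> (\<forall>l\<in>block p - {p}. S $ p $ l = s $ l / 2)"
      unfolding block_pos_image(2)[OF p(1)] by (simp add: p(2) hd[unfolded p(2)] blk_def)
    \<comment> \<open>By symmetry \<open>contract\<close> counts each border entry twice, which
      matches the factor 1/2 in the admissibility condition.\<close>
    also have "\<dots> \<longleftrightarrow> (\<forall>l\<in>block p - {p}. contract S $ l = s $ l)"
      using psd_sym[OF True] by (intro ball_cong) (auto simp: contract_def block_def)
    finally have off_head: "(\<forall>j\<in>{2..n i}. S $ ix (ublk n i) $ ix (ublk n i + j - 1) = blk n s i j / 2)
        \<longleftrightarrow> (\<forall>l\<in>block p - {p}. contract S $ l = s $ l)" .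
    have "p \<in> block p"
      using p by (simp add: block_def)
    then show ?thesis
      unfolding tr hd(2) off_head by blast
  qed
  have "(\<forall>p. head p = p \<longrightarrow> (\<forall>h\<in>block p. contract S $ h = s $ h)) \<longleftrightarrow> contract S = s"
  proof
    assume all: "\<forall>p. head p = p \<longrightarrow> (\<forall>h\<in>block p. contract S $ h = s $ h)"
    have "contract S $ h = s $ h" for h
      using all[rule_format, of "head h" h] by (simp add: block_def)
    then show "contract S = s"
      by (simp add: vec_eq_iff)
  qed simp
  moreover have "(\<forall>i\<in>{1..r}. (\<Sum>j = ublk n i..ublk n i + n i - 1. S $ ix j $ ix j) = blk n s i 1
      \<and> (\<forall>j\<in>{2..n i}. S $ ix (ublk n i) $ ix (ublk n i + j - 1) = blk n s i j / 2))
      \<longleftrightarrow> (\<forall>p. head p = p \<longrightarrow> (\<forall>h\<in>block p. contract S $ h = s $ h))"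
    unfolding all_blocks_iff[where Q = "\<lambda>i. (\<Sum>j = ublk n i..ublk n i + n i - 1. S $ ix j $ ix j) = blk n s i 1
      \<and> (\<forall>j\<in>{2..n i}. S $ ix (ublk n i) $ ix (ublk n i + j - 1) = blk n s i j / 2)"]
    using eq[OF _ refl] by blast
  ultimately show ?thesis
    unfolding admissible_slack_def head_eq_iff using True by blast
qed (simp add: admissible_slack_def)

lemma finite_admissible_ranks: "finite {rank (S :: ('k, 'k) rmat) |S. admissible_slack r n s S}"
proof (rule finite_subset)
  have "rank S \<le> CARD('k)" for S :: "('k, 'k) rmat"
    using rank_bound[of S] by simp
  then show "{rank (S :: ('k, 'k) rmat) |S. admissible_slack r n s S} \<subseteq> {..CARD('k)}"
    by auto
qed simp

text \<open>The midpoint \<open>U\<close> of \<open>S\<close> and \<open>T\<close> is admissible,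
  and its kernel is the intersection of theirs. Its rank cannot exceed that of \<open>S\<close>, so
  the two kernels agree and the kernel of \<open>S\<close> lies in that of \<open>T\<close>.\<close>

lemma max_rank_kernel:
  fixes S T :: "('k, 'k) rmat"
  assumes S: "admissible_slack r n s S" "rank S = rho r n s" and T: "admissible_slack r n s T"
    and x: "S *v x = 0"
  shows "T *v x = 0"
proof -
  define U where "U = (1/2) *\<^sub>R S + (1/2) *\<^sub>R T"
  have psd: "psd S" "psd T"
    using S T by (simp_all add: admissible_slack_iff)
  then have "psd U"
    unfolding U_def by (intro psd_add psd_scaleR) simp_all
  have "admissible_slack r n s U"
    using S(1) T \<open>psd U\<close> unfolding admissible_slack_iff
    by (simp add: U_def linear_add[OF linear_contract] linear_scale[OF linear_contract] flip: scaleR_add_left)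
  then have "rank U \<le> rank S"
    unfolding S(2) rho_def using finite_admissible_ranks by (intro Max_ge) auto
  have kerU: "S *v x = 0 \<and> T *v x = 0" if "U *v x = 0" for x
  proof -
    have "x \<bullet> (S *v x) + x \<bullet> (T *v x) = 2 * (x \<bullet> (U *v x))"
      by (simp add: U_def matrix_vector_mult_add_rdistrib scaleR_matrix_vector inner_add_right)
    moreover have "0 \<le> x \<bullet> (S *v x)" "0 \<le> x \<bullet> (T *v x)"
      using psd by (simp_all add: psd_def)
    ultimately have "x \<bullet> (S *v x) = 0" "x \<bullet> (T *v x) = 0"
      using that by auto
    then show ?thesis
      using psd by (simp add: psd_form_eq_0_iff)
  qed
  then have "U *v x = 0"
    using psd_kernel_eq_of_rank_le[OF psd(1) \<open>psd U\<close> _ \<open>rank U \<le> rank S\<close> x] by blast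
  then show ?thesis
    using kerU by blast
qed

text \<open>An optimal slack of the SDO dual may have entries between different blocks, since
  \<open>v\<close> is free there. Deleting them preserves semidefiniteness and
  \<open>contract\<close>, and gives a matrix that is admissible for its contraction.\<close>

definition block_part :: "('k, 'k) rmat \<Rightarrow> ('k, 'k) rmat"
  where "block_part S = (\<chi> h l. if head h = head l then S $ h $ l else 0)"

text \<open>Indexing by all \<open>p\<close> instead of the heads alone is harmless, as the vector
  is zero when \<open>p\<close> is not a head.\<close>

definition block_vec :: "'k rvec \<Rightarrow> 'k \<Rightarrow> 'k rvec"
  where "block_vec x p = (\<chi> h. if head h = p then x $ h else 0)"

lemma sum_block_vec: "(\<Sum>p\<in>UNIV. block_vec x p) = x"
  by (simp add: vec_eq_iff block_vec_def)

lemma block_part_form: "x \<bullet> (block_part S *v x) = (\<Sum>p\<in>UNIV. block_vec x p \<bullet> (S *v block_vec x p))"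
proof -
  have "(\<Sum>p\<in>UNIV. block_vec x p \<bullet> (S *v block_vec x p))
      = (\<Sum>p\<in>UNIV. \<Sum>h\<in>UNIV. \<Sum>l\<in>UNIV. block_vec x p $ h * (S $ h $ l * block_vec x p $ l))"
    by (simp add: inner_vec_def matrix_vector_mult_def sum_distrib_left)
  also have "\<dots> = (\<Sum>h\<in>UNIV. \<Sum>p\<in>UNIV. \<Sum>l\<in>UNIV. block_vec x p $ h * (S $ h $ l * block_vec x p $ l))"
    by (rule sum.swap)
  also have "\<dots> = (\<Sum>h\<in>UNIV. \<Sum>l\<in>UNIV. \<Sum>p\<in>UNIV. block_vec x p $ h * (S $ h $ l * block_vec x p $ l))"
    by (intro sum.cong refl sum.swap)
  also have "\<dots> = (\<Sum>h\<in>UNIV. \<Sum>l\<in>UNIV. \<Sum>p\<in>UNIV. if p = head h then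
      if head h = head l then x $ h * (S $ h $ l * x $ l) else 0 else 0)"
    by (intro sum.cong refl) (auto simp: block_vec_def)
  also have "\<dots> = (\<Sum>h\<in>UNIV. \<Sum>l\<in>UNIV. if head h = head l then x $ h * (S $ h $ l * x $ l) else 0)"
    by (simp only: sum.delta finite_class.finite_UNIV UNIV_I if_True)
  also have "\<dots> = x \<bullet> (block_part S *v x)"
    by (auto simp: inner_vec_def matrix_vector_mult_def sum_distrib_left block_part_def intro!: sum.cong)
  finally show ?thesis ..
qed

lemma psd_block_part: "psd S \<Longrightarrow> psd (block_part S)"
  using psd_sym[of S]
  by (auto simp: psd_def block_part_form intro: sum_nonneg) (auto simp: block_part_def transpose_def vec_eq_iff)

text \<open>The form of the block diagonal part is a sum of nonnegative forms of \<open>S\<close> at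
  the pieces of \<open>x\<close>. If it vanishes, \<open>S\<close> annihilates every piece and hence
  their sum \<open>x\<close>, even across blocks.\<close>

lemma block_part_kernel:
  assumes "psd S" "block_part S *v x = 0"
  shows "S *v x = 0"
proof -
  have "(\<Sum>p\<in>UNIV. block_vec x p \<bullet> (S *v block_vec x p)) = 0"
    using assms(2) by (simp flip: block_part_form)
  then have "block_vec x p \<bullet> (S *v block_vec x p) = 0" for p
    using assms(1) by (subst (asm) sum_nonneg_eq_0_iff) (auto simp: psd_def)
  then have "S *v block_vec x p = 0" for p
    by (simp add: psd_form_eq_0_iff[OF assms(1)])
  then have "(\<Sum>p\<in>UNIV. S *v block_vec x p) = 0"
    by simp
  then show ?thesis
    by (simp add: sum_block_vec flip: linear_sum[OF matrix_vector_mul_linear])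
qed

lemma contract_block_part: "contract (block_part S) = contract S"
  by (auto simp: contract_def block_part_def vec_eq_iff)


section \<open>Relative interior of the dual SDO optimal set\<close>

lemma convex_D_SDO:
  fixes A :: "('k, 'm::finite) rmat"
  shows "convex {d. D_SDO n A c d}"
proof (rule convexI)
  fix d d' :: "('k, 'm) sdo_dual" and u w :: real
  assume d: "d \<in> {d. D_SDO n A c d}" "d' \<in> {d. D_SDO n A c d}" and uw: "0 \<le> u" "0 \<le> w" "u + w = 1"
  obtain y v z S y' v' z' S' where eq: "d = (y, v, z, S)" "d' = (y', v', z', S')"
    by (metis prod_cases4)
  have "psd (u *\<^sub>R S + w *\<^sub>R S')"
    using d uw by (intro psd_add psd_scaleR) (auto simp: D_SDO_def eq)
  then show "u *\<^sub>R d + w *\<^sub>R d' \<in> {d. D_SDO n A c d}"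
    using affine_constraint_D_SDO[of n d A c d' u w] d uw(3) by (simp add: D_SDO_def eq)
qed

text \<open>The slack decomposes as \<open>s = s''/e + (1 - 1/e) s'\<close> with \<open>s'\<close> the slack of the competitor, so averaging an
  admissible matrix for \<open>s''\<close> with the block diagonal part of \<open>S'\<close> gives a matrix admissible for \<open>s\<close>.\<close>

lemma kernel_subset_of_max_rank:
  fixes A :: "('k, 'm::finite) rmat" and S S' :: "('k, 'k) rmat"
  assumes ri: "(y, s) \<in> rel_interior (D_SOCO_opt r n A b c)"
    and S: "admissible_slack r n s S" "rank S = rho r n s"
    and lift: "\<And>s. s \<in> lorentz_prod r n \<Longrightarrow> \<exists>S :: ('k, 'k) rmat. admissible_slack r n s S"
    and S': "psd S'" "(y', contract S') \<in> D_SOCO_opt r n A b c"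
    and x: "S *v x = 0"
  shows "S' *v x = 0"
proof -
  obtain e where e: "e > 1" "(1 - e) *\<^sub>R (y', contract S') + e *\<^sub>R (y, s) \<in> D_SOCO_opt r n A b c"
    using ri S'(2) convex_rel_interior_iff[OF convex_D_SOCO_opt, of A b c "(y, s)"] by blast
  define s'' where "s'' = (1 - e) *\<^sub>R contract S' + e *\<^sub>R s"
  have "s'' \<in> lorentz_prod r n"
    using e(2) by (simp add: D_SOCO_opt_def is_arg_max_def D_SOCO_def s''_def)
  then obtain S'' where S'': "admissible_slack r n s'' S''"
    using lift by blast
  define T where "T = (1 - 1 / e) *\<^sub>R block_part S' + (1 / e) *\<^sub>R S''"
  have psd: "psd (block_part S')" "psd S''"
    using S'(1) S'' psd_block_part by (simp_all add: admissible_slack_iff)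
  have "psd T"
    unfolding T_def using psd e(1) by (intro psd_add psd_scaleR) auto
  moreover have "contract T = s"
    using S'' e(1)
    by (simp add: T_def linear_add[OF linear_contract] linear_scale[OF linear_contract] contract_block_part
        admissible_slack_iff s''_def vec_eq_iff field_simps)
  ultimately have "admissible_slack r n s T"
    using S'' by (simp add: admissible_slack_iff T_def block_part_def)
  then have "T *v x = 0"
    using max_rank_kernel S x by blast
  \<comment> \<open>Both summands are nonnegative, so each vanishes; \<open>e > 1\<close> makes the
    weight of the block diagonal part positive.\<close>
  then have "(1 - 1 / e) * (x \<bullet> (block_part S' *v x)) + (1 / e) * (x \<bullet> (S'' *v x)) = 0"
    by (simp add: T_def matrix_vector_mult_add_rdistrib scaleR_matrix_vector flip: inner_add_right inner_scaleR_right)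
  moreover have "0 \<le> (1 - 1 / e) * (x \<bullet> (block_part S' *v x))" "0 \<le> (1 / e) * (x \<bullet> (S'' *v x))"
    using psd e(1) by (simp_all add: psd_def)
  ultimately have "(1 - 1 / e) * (x \<bullet> (block_part S' *v x)) = 0"
    by linarith
  then have "block_part S' *v x = 0"
    using e(1) by (simp add: psd_form_eq_0_iff[OF psd(1)])
  then show ?thesis
    using block_part_kernel[OF S'(1)] by blast
qed

text \<open>In a convex set a point is relatively interior if from every other point of the set one
  can move slightly beyond it. Equality constraints and objective survive such a move by linearity,
  and the kernel inclusion keeps the slack semidefinite by \<open>psd_extrapolate\<close>.\<close>

lemma D_SDO_rel_interior:
  fixes A :: "('k, 'm::finite) rmat" and S :: "('k, 'k) rmat"
  assumes ri: "(y, s) \<in> rel_interior (D_SOCO_opt r n A b c)"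
    and S: "admissible_slack r n s S" "rank S = rho r n s"
    and lift: "\<And>s. s \<in> lorentz_prod r n \<Longrightarrow> \<exists>S :: ('k, 'k) rmat. admissible_slack r n s S"
    and feasible: "D_SDO n A c (y, v, z, S)"
  shows "(y, v, z, S) \<in> rel_interior (D_SDO_opt n A b c)"
proof -
  have s: "contract S = s" and "psd S"
    using S(1) by (simp_all add: admissible_slack_iff)
  have opt: "(y, contract S) \<in> D_SOCO_opt r n A b c"
    using ri rel_interior_subset s by blast
  note iff = D_SDO_opt_iff[OF feasible opt]
  \<comment> \<open>Optimality constrains only \<open>y\<close>, hence the normal vector with zeros
    in the other components.\<close>
  have "D_SDO_opt n A b c = {d. D_SDO n A c d} \<inter> {d. (b, 0, 0, 0) \<bullet> d = b \<bullet> y}"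
    using iff by auto
  then have "convex (D_SDO_opt n A b c)"
    by (auto intro: convex_Int convex_D_SDO convex_hyperplane)
  moreover have mem: "(y, v, z, S) \<in> D_SDO_opt n A b c"
    using feasible by (simp add: iff)
  moreover have "\<exists>e>1. (1 - e) *\<^sub>R d + e *\<^sub>R (y, v, z, S) \<in> D_SDO_opt n A b c"
    if d: "d \<in> D_SDO_opt n A b c" for d
  proof -
    obtain y' v' z' S' where eq: "d = (y', v', z', S')"
      by (metis prod_cases4)
    have d': "D_SDO n A c (y', v', z', S')" "b \<bullet> y' = b \<bullet> y"
      using d by (simp_all add: eq iff)
    have psd: "psd S'"
      using d'(1) by (simp add: D_SDO_def)
    have "(y', contract S') \<in> D_SOCO_opt r n A b c"
      using D_SDO_imp_D_SOCO[OF d'(1)] d'(2) D_SOCO_opt_eq[OF opt] by simp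
    then have "S' *v x = 0" if "S *v x = 0" for x
      using kernel_subset_of_max_rank[OF ri S lift psd _ that] by blast
    then obtain e where e: "e > 1" "psd ((1 - e) *\<^sub>R S' + e *\<^sub>R S)"
      using psd_extrapolate[OF \<open>psd S\<close> psd] by blast
    have "b \<bullet> ((1 - e) *\<^sub>R y' + e *\<^sub>R y) = b \<bullet> y"
      by (simp add: inner_add_right d'(2) algebra_simps)
    moreover have "D_SDO n A c ((1 - e) *\<^sub>R d + e *\<^sub>R (y, v, z, S))"
      using affine_constraint_D_SDO[of n d A c "(y, v, z, S)" "1 - e" e] d'(1) feasible e(2)
      by (simp add: D_SDO_def eq)
    ultimately show ?thesis
      using e(1) by (auto simp: eq iff)
  qed
  ultimately show ?thesis
    by (subst convex_rel_interior_iff) auto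
qed

end

theorem theorem5p3:
  fixes r :: nat and n :: "nat \<Rightarrow> nat"
    and A :: "('k::{finite,linorder}, 'm::finite) rmat" and b :: "'m rvec" and c :: "'k rvec"
    and x :: "'k rvec" and y :: "'m rvec" and s :: "'k rvec"
    and M :: "'k rvec \<times> 'm rvec \<times> 'k rvec \<Rightarrow> ('k, 'k) rmat \<times> ('k, 'm) sdo_dual"
  assumes "r \<ge> 1" and "\<And>i. i \<in> {1..r} \<Longrightarrow> n i \<ge> 1" and "CARD('k) = (\<Sum>i = 1..r. n i)"
    and "max_complementary (P_SOCO_opt r n A b c) (D_SOCO_opt r n A b c) (x, (y, s))"
    and "proper_soco_map r n A c M"
  shows "M (x, y, s) \<in> P_SDO_opt n A b c \<times> D_SDO_opt n A b c
    \<and> max_complementary (P_SDO_opt n A b c) (D_SDO_opt n A b c) (M (x, y, s))"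
proof -
  interpret block_structure r n "\<lambda>h :: 'k. ix (ublk n (Cf n h))"
    by unfold_locales (use assms(2,3) in auto)
  have ri: "x \<in> rel_interior (P_SOCO_opt r n A b c)" "(y, s) \<in> rel_interior (D_SOCO_opt r n A b c)"
    using assms(4) by (auto simp: max_complementary_def)
  have x: "x \<in> lorentz_prod r n"
    using assms(4) by (auto simp: max_complementary_def P_SOCO_opt_def is_arg_min_def P_SOCO_def)
  have "D_SOCO r n A c (y, s)"
    using assms(4) by (auto simp: max_complementary_def D_SOCO_opt_def is_arg_max_def)
  then have s: "s \<in> lorentz_prod r n" and c: "transpose A *v y + s = c"
    unfolding D_SOCO_def by auto
  have admissible: "admissible_map r n A c M"
    using assms(5) by (simp add: proper_soco_map_def)
  \<comment> \<open>No explicit matrix is built: \<open>M\<close> is total, and its value at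
    \<open>(x, y, s')\<close> contains an admissible slack for any \<open>s'\<close> in the cone,
    whether or not \<open>(y, s')\<close> is dual feasible.\<close>
  have lift: "\<exists>S :: ('k, 'k) rmat. admissible_slack r n s' S" if "s' \<in> lorentz_prod r n" for s'
  proof -
    obtain X y' v z S where "M (x, y, s') = (X, y', v, z, S)"
      by (metis prod_cases5)
    then show ?thesis
      using admissible x that unfolding admissible_map_def by blast
  qed
  obtain X y' v z S where M: "M (x, y, s) = (X, y', v, z, S)"
    by (metis prod_cases5)
  then have eq: "X = DArw n (blk n x)" "y' = y" and S: "admissible_slack r n s S"
    and "supp_vz n v z" "D_SDO_eq n A c (y', v, z, S)"
    using admissible x s c unfolding admissible_map_def by blast+
  then have feasible: "D_SDO n A c (y, v, z, S)"
    using S by (simp add: D_SDO_def admissible_slack_def)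
  have rank: "rank S = rho r n s"
    using assms(5) M x s unfolding proper_soco_map_def by blast
  \<comment> \<open>Relative interiors commute with injective linear maps.\<close>
  have "rel_interior (P_SDO_opt n A b c) = (\<lambda>x. arrow x x) ` rel_interior (P_SOCO_opt r n A b c)"
    unfolding P_SDO_opt_eq
    by (intro rel_interior_injective_linear_image inj_arrow) (simp add: linear_arrow linear_conv_bounded_linear[symmetric])
  then have "X \<in> rel_interior (P_SDO_opt n A b c)"
    using ri(1) by (simp add: eq(1) DArw_blk)
  moreover have "(y, v, z, S) \<in> rel_interior (D_SDO_opt n A b c)"
    by (rule D_SDO_rel_interior[OF ri(2) S rank lift feasible])
  ultimately show ?thesis
    using rel_interior_subset[of "P_SDO_opt n A b c"] rel_interior_subset[of "D_SDO_opt n A b c"]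
    by (auto simp: M eq(2) max_complementary_def)
qed

end
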